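(* Let $f(\zeta,t)$ be a locally univalent solution of the Polubarinova-Galin equation with $g=f'$ rational, $$g(\zeta,t)=b(t)\frac{\prod_{k=1}^{m}(\zeta-\omega_k(t))}{\prod_{j=1}^{n}(\zeta-\zeta_j(t))},\qquad m\ge n,$$ and assume that the zeros $\omega_1,\dots,\omega_m$ of $g$ are simple. Then $$\frac{d}{dt}\log\omega_k=P^*(\omega_k,t)-\frac{2A_k}{\omega_k}\left(1+\sum_{j=1}^m\frac{1}{1-\overline{\omega}_j\omega_k}-\sum_{j=1}^n\frac{1}{1-\overline{\zeta}_j\omega_k}\right)\qquad(1\le k\le m),$$ $$\frac{d}{dt}\log\zeta_j=P^*(\zeta_j,t)\qquad(1\le j\le n),$$ where $A_k$ is given by $$\frac{2A_k}{\omega_k}=\frac{2q(t)}{\omega_k\,g'(\omega_k,t)\,g^*(\omega_k,t)}.$$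
   Context: Notation: $\mathbb{D}$ is the open unit disk; dot denotes $\partial/\partial t$, prime denotes $\partial/\partial\zeta$; for a function $h$, $h^*(\zeta)=\overline{h(1/\bar\zeta)}$. Locally univalent solution: for $t$ in a time interval, $f(\cdot,t)$ is analytic in a neighborhood of $\overline{\mathbb{D}}$, $f(0,t)=0$, $f'(0,t)>0$, $f'(\zeta,t)\neq0$ for $\zeta\in\overline{\mathbb{D}}$, $f$ depends smoothly on $t$, and $\operatorname{Re}[\dot f(\zeta,t)\overline{\zeta f'(\zeta,t)}]=q(t)$ for $\zeta\in\partial\mathbb{D}$, where $q$ is a given real-valued continuous function. Equivalently $\dot f=\zeta f'P$ in $\mathbb{D}$ with $$P(\zeta,t)=\frac{1}{2\pi i}\int_{\partial\mathbb{D}}\frac{q(t)}{|f'(z,t)|^2}\,\frac{z+\zeta}{z-\zeta}\,\frac{dz}{z}\qquad(\zeta\in\mathbb{D}).$$ The reflected Poisson integral is $P^*(\zeta,t)=\overline{P(1/\bar\zeta,t)}$, in particular defined by this formula for $|\zeta|>1$. Form of $g=f'$: $b(t)\neq0$, $|\omega_k|>1$, $|\zeta_j|>1$, no zero coincides with a pole; poles are repeated according to multiplicity; $m,n$ are fixed on the time interval considered. *)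

theory Defs
  imports "HOL-Complex_Analysis.Complex_Analysis"
begin

definition reflect :: "(complex \<Rightarrow> complex) \<Rightarrow> complex \<Rightarrow> complex" where
  "reflect h z = cnj (h (1 / cnj z))"

(* "Smoothly in t" is taken as C^1: the time derivative f_t exists and is jointly continuous on
   the closed disc times I.  As q is only assumed continuous, no higher smoothness in t can be
   expected.  The interval I may contain its end points, where derivatives are one-sided. *)
definition locally_univalent_PG_solution ::
    "real set \<Rightarrow> (real \<Rightarrow> real) \<Rightarrow> (complex \<Rightarrow> real \<Rightarrow> complex) \<Rightarrow> bool" where
  "locally_univalent_PG_solution I q f \<longleftrightarrow>
     is_interval I \<and> interior I \<noteq> {} \<and> continuous_on I q \<and>
     (\<forall>t\<in>I. (\<lambda>z. f z t) analytic_on cball 0 1 \<and> f 0 t = 0 \<and>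
        Im (deriv (\<lambda>z. f z t) 0) = 0 \<and> Re (deriv (\<lambda>z. f z t) 0) > 0 \<and>
        (\<forall>z\<in>cball 0 1. deriv (\<lambda>z. f z t) z \<noteq> 0)) \<and>
     (\<exists>f\<^sub>t. (\<forall>t\<in>I. \<forall>z\<in>cball 0 1. (f z has_vector_derivative f\<^sub>t z t) (at t within I)) \<and>
        continuous_on (cball 0 1 \<times> I) (\<lambda>(z, t). f\<^sub>t z t) \<and>
        (\<forall>t\<in>I. \<forall>z\<in>sphere 0 1. Re (f\<^sub>t z t * cnj (z * deriv (\<lambda>z. f z t) z)) = q t))"

definition PG_Poisson ::
    "(real \<Rightarrow> real) \<Rightarrow> (complex \<Rightarrow> real \<Rightarrow> complex) \<Rightarrow> complex \<Rightarrow> real \<Rightarrow> complex" where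
  "PG_Poisson q f \<zeta> t =
     1 / (2 * of_real pi * \<i>) *
     contour_integral (circlepath 0 1)
       (\<lambda>z. of_real (q t / (cmod (deriv (\<lambda>x. f x t) z))\<^sup>2) * ((z + \<zeta>) / (z - \<zeta>)) / z)"

(* d/dt log w = D at t, for a local branch L of log w; the choice of branch is immaterial. *)
definition has_log_derivative ::
    "(real \<Rightarrow> complex) \<Rightarrow> complex \<Rightarrow> real \<Rightarrow> real set \<Rightarrow> bool" where
  "has_log_derivative w D t I \<longleftrightarrow>
     (\<exists>L. exp (L t) = w t \<and> (\<forall>\<^sub>F s in at t within I. exp (L s) = w s) \<and>
          (L has_vector_derivative D) (at t within I))"

end

theory Submission
  imports Defs
begin

text \<open>
  Writing \<open>F = f\<^sub>t = \<zeta> g P\<close>, the logarithmic derivative \<open>g' / g\<close> is a sum of simple poles (residue \<open>1\<close> at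
  each zero of \<open>g\<close>, minus the multiplicity at each pole), and its time derivative in the disc is
  \<open>(F' / g)'\<close>. As long as coinciding poles stay together, interpolating the numerators of the
  difference quotients of this rational function shows that the zeros and poles \<open>a\<^sub>x\<close> are
  differentiable in time, so that \<open>F' / g\<close> is rational with simple poles whose coefficients are
  the velocities. On the other hand \<open>P + P* = 2 q / (g g*)\<close> on the circle, hence
  \<open>F\<close> continues to the exterior as \<open>2 q \<zeta> / g* - \<zeta> g P*\<close>. Comparing the behaviour of both
  expressions at \<open>a\<^sub>x\<close> gives the velocities.

  Poles cannot split or merge: where the number of distinct poles is maximal the above applies, two
  poles \<open>\<zeta>\<^sub>i, \<zeta>\<^sub>j\<close> follow the same Lipschitz velocity field \<open>z P*(z)\<close>, and a Gronwall argument run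
  backwards from a first collision shows that they coincided before.
\<close>

section \<open>Derivatives in time\<close>

text \<open>The roots \<open>\<omega> k\<close> and \<open>\<zeta> j\<close> are assumed only
  continuous in time, so their differentiability has to be proved. For a multiple pole this is no
  formality: a pair of poles c + sqrt t, c - sqrt t leaves \<open>g\<close> smooth in t, yet neither
  pole is differentiable at the collision. Splitting and merging therefore cannot be excluded by
  smoothness of \<open>g\<close>; the evolution itself has to exclude them. Passing to the
  logarithmic derivative makes every pole simple and turns multiplicities into residues, which are
  constant in time as long as coinciding poles stay together. The time derivative of
  \<open>f\<close> is known to be merely continuous on the closed disc, so its inner and outer
  expressions match only continuously on the circle and must be pasted. The comparison at a root
  multiplies by \<open>(z - a x) / g z\<close>. At a simple zero this tends to the reciprocal of the
  derivative of \<open>g\<close>, the source of the A_k term; at a pole of any multiplicity it tends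
  to 0, so only the term with P* remains.\<close>

lemma gronwall_vanish:
  fixes w w' :: "real \<Rightarrow> complex"
  assumes cont: "continuous_on (closed_segment a c) w" and "w c = 0"
    and der: "\<And>s. s \<in> open_segment a c \<Longrightarrow> (w has_vector_derivative w' s) (at s)"
    and bd: "\<And>s. s \<in> open_segment a c \<Longrightarrow> norm (w' s) \<le> K * norm (w s)"
    and K: "0 \<le> K" "K * \<bar>a - c\<bar> \<le> 1 / 2"
    and s: "s \<in> closed_segment a c"
  shows "w s = 0"
proof -
  have "continuous_on (closed_segment a c) (\<lambda>s. norm (w s))"
    by (intro continuous_intros cont)
  then obtain x where x: "x \<in> closed_segment a c"
    and xmax: "\<And>s. s \<in> closed_segment a c \<Longrightarrow> norm (w s) \<le> norm (w x)"
    using continuous_attains_sup[of "closed_segment a c" "\<lambda>s. norm (w s)"] by auto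
  \<comment> \<open>\<open>x\<close> maximises the norm of \<open>w\<close>. The mean value
    inequality between \<open>x\<close> and the zero \<open>c\<close> bounds this maximum by
    \<open>K * \<bar>a - c\<bar>\<close> times itself, hence by half of itself.\<close>
  have "norm (w x) \<le> norm (w x) / 2"
  proof (cases "x = c")
    case False
    define l u where "l = min x c" and "u = max x c"
    have lu: "l < u" using False by (auto simp: l_def u_def)
    have sub: "{l..u} \<subseteq> closed_segment a c"
      using x by (auto simp: l_def u_def closed_segment_eq_real_ivl split: if_splits)
    have sub': "y \<in> open_segment a c" if "l < y" "y < u" for y
      using x that by (auto simp: l_def u_def open_segment_eq_real_ivl closed_segment_eq_real_ivl split: if_splits)
    obtain y where y: "l < y" "y < u" "norm (w u - w l) \<le> norm ((u - l) *\<^sub>R w' y)"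
      using mvt_general[of l u w "\<lambda>y h. h *\<^sub>R w' y"] lu der sub'
        continuous_on_subset[OF cont sub] unfolding has_vector_derivative_def by auto
    have "norm (w x) = norm (w u - w l)"
      using \<open>w c = 0\<close> by (auto simp: l_def u_def min_def max_def norm_minus_commute)
    also have "\<dots> \<le> (u - l) * norm (w' y)" using y lu by simp
    also have "\<dots> \<le> (u - l) * (K * norm (w y))"
      using y lu by (intro mult_left_mono bd sub') auto
    also have "\<dots> \<le> (u - l) * (K * norm (w x))"
      using xmax[of y] y lu K subsetD[OF sub, of y] by (intro mult_left_mono) auto
    also have "\<dots> \<le> \<bar>a - c\<bar> * (K * norm (w x))"
      using x K by (intro mult_right_mono)
        (auto simp: l_def u_def closed_segment_eq_real_ivl split: if_splits)
    also have "\<dots> = (K * \<bar>a - c\<bar>) * norm (w x)" by simp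
    also have "\<dots> \<le> 1 / 2 * norm (w x)" using K by (intro mult_right_mono) auto
    finally show ?thesis by simp
  qed (use \<open>w c = 0\<close> in auto)
  with xmax[OF s] have "norm (w s) \<le> 0" by linarith
  then show ?thesis by simp
qed

text \<open>Joint continuity and compactness of \<open>K\<close> make \<open>ft z s\<close> tend to
  \<open>ft z t\<close> uniformly in \<open>z\<close>; the mean value inequality in time passes this
  on to the quotients. The uniformity is what allows differentiation in \<open>z\<close> under the
  limit.\<close>

lemma uniform_limit_time_difference_quotient:
  fixes f ft :: "'a::metric_space \<Rightarrow> real \<Rightarrow> complex"
  assumes I: "is_interval I" "t \<in> I" and K: "compact K"
    and der: "\<And>s z. s \<in> I \<Longrightarrow> z \<in> K \<Longrightarrow> (f z has_vector_derivative ft z s) (at s within I)"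
    and cont: "continuous_on (K \<times> I) (\<lambda>(z, s). ft z s)"
  shows "uniform_limit K (\<lambda>s z. (f z s - f z t) / of_real (s - t)) (\<lambda>z. ft z t) (at t within I)"
proof (rule uniform_limitI)
  fix e :: real assume "e > 0"
  have "continuous_on (I \<times> K) ((\<lambda>(z, s). ft z s) \<circ> prod.swap)"
    by (intro continuous_on_compose continuous_on_subset[OF cont] continuous_on_swap) auto
  then obtain X0 where X0: "t \<in> X0" "open X0"
      "\<forall>s\<in>X0 \<inter> I. \<forall>z\<in>K. dist (ft z s) (ft z t) \<le> e / 2"
    using continuous_on_prod_compactE[of I K "(\<lambda>(z, s). ft z s) \<circ> prod.swap" t "e/2"] K I \<open>e > 0\<close>
    by auto
  obtain d where d: "d > 0" "ball t d \<subseteq> X0" using X0 open_contains_ball by blast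
  have "\<forall>z\<in>K. dist ((f z s - f z t) / of_real (s - t)) (ft z t) < e"
    if s: "s \<in> I" "s \<noteq> t" "dist s t < d" for s
  proof
    fix z assume z: "z \<in> K"
    let ?S = "I \<inter> ball t d"
    have "convex ?S" using I by (intro convex_Int) (auto simp: is_interval_convex_1)
    then have seg: "closed_segment t s \<subseteq> ?S"
      using s I d by (intro closed_segment_subset) (auto simp: dist_commute)
    have "norm (f z s - f z t - (s - t) *\<^sub>R ft z t) \<le> norm (s - t) * (e / 2)"
    proof (rule vector_differentiable_bound_linearization[OF _ seg])
      show "(f z has_vector_derivative ft z x) (at x within ?S)" if "x \<in> ?S" for x
        by (rule has_vector_derivative_within_subset[OF der]) (use that z in auto)
      show "norm (ft z x - ft z t) \<le> e / 2" if "x \<in> ?S" for x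
        using X0(3) z that d(2) by (auto simp: dist_norm)
    qed (use I d in auto)
    moreover have "dist ((f z s - f z t) / of_real (s - t)) (ft z t)
        = norm (f z s - f z t - (s - t) *\<^sub>R ft z t) / norm (s - t)"
    proof -
      have "(f z s - f z t) / of_real (s - t) - ft z t = (f z s - f z t - (s - t) *\<^sub>R ft z t) / of_real (s - t)"
        using s by (simp add: scaleR_conv_of_real divide_simps del: of_real_diff)
      then show ?thesis by (simp add: dist_norm norm_divide del: of_real_diff)
    qed
    ultimately have "dist ((f z s - f z t) / of_real (s - t)) (ft z t) \<le> e / 2"
      using s by (simp add: pos_divide_le_eq mult.commute)
    then show "dist ((f z s - f z t) / of_real (s - t)) (ft z t) < e" using \<open>e > 0\<close> by simp
  qed
  then show "\<forall>\<^sub>F s in at t within I. \<forall>z\<in>K. dist ((f z s - f z t) / of_real (s - t)) (ft z t) < e"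
    unfolding eventually_at using d by (auto simp: dist_commute)
qed

text \<open>Complex division makes the algebra of complex limits and the limit theorems for
  holomorphic functions applicable. It differs from scaling by \<open>\<bar>s - t\<bar>\<close> only
  by a sign, which the norm ignores.\<close>

lemma has_vector_derivative_iff_difference_quotient:
  fixes h :: "real \<Rightarrow> complex"
  shows "(h has_vector_derivative D) (at t within I) \<longleftrightarrow>
    ((\<lambda>s. (h s - h t) / of_real (s - t)) \<longlongrightarrow> D) (at t within I)"
proof -
  have "norm ((h s - h t) /\<^sub>R \<bar>s - t\<bar> - ((s - t) *\<^sub>R D) /\<^sub>R \<bar>s - t\<bar>)
      = norm ((h s - h t) / of_real (s - t) - D)" if "s \<noteq> t" for s
  proof -
    have "(h s - h t) /\<^sub>R \<bar>s - t\<bar> - ((s - t) *\<^sub>R D) /\<^sub>R \<bar>s - t\<bar>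
        = of_real (sgn (s - t)) * ((h s - h t) / of_real (s - t) - D)"
      using that by (cases "s > t") (simp_all add: scaleR_conv_of_real divide_simps, simp add: algebra_simps)
    then show ?thesis using that by (simp add: norm_mult sgn_if)
  qed
  then have "((\<lambda>s. (h s - h t) /\<^sub>R \<bar>s - t\<bar> - ((s - t) *\<^sub>R D) /\<^sub>R \<bar>s - t\<bar>) \<longlongrightarrow> 0) (at t within I)
     \<longleftrightarrow> ((\<lambda>s. (h s - h t) / of_real (s - t) - D) \<longlongrightarrow> 0) (at t within I)"
    by (subst (1 2) tendsto_norm_zero_iff[symmetric]) (intro tendsto_cong, simp add: eventually_at_filter)
  then show ?thesis
    unfolding has_vector_derivative_def has_derivative_within
    by (simp add: LIM_zero_iff bounded_linear_scaleR_left scaleR_diff_right diff_diff_eq scaleR_add_right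
        divide_inverse del: of_real_diff)
qed

text \<open>Weierstrass' theorem: the time quotients are holomorphic in \<open>z\<close> and
  converge uniformly, so their derivatives in \<open>z\<close> of every order converge. Time and
  space derivatives commute without any assumption on mixed derivatives.\<close>

lemma higher_deriv_time_derivative:
  fixes f ft :: "complex \<Rightarrow> real \<Rightarrow> complex"
  assumes I: "is_interval I" "t \<in> I" "t islimpt I"
    and der: "\<And>s z. s \<in> I \<Longrightarrow> z \<in> cball 0 1 \<Longrightarrow> (f z has_vector_derivative ft z s) (at s within I)"
    and cont: "continuous_on (cball 0 1 \<times> I) (\<lambda>(z, s). ft z s)"
    and hol: "\<And>s. s \<in> I \<Longrightarrow> (\<lambda>z. f z s) analytic_on cball 0 1"
  shows "(\<lambda>z. ft z t) holomorphic_on ball 0 1"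
    and "z \<in> ball 0 1 \<Longrightarrow> ((\<lambda>s. (deriv ^^ k) (\<lambda>z. f z s) z) has_vector_derivative
           (deriv ^^ k) (\<lambda>z. ft z t) z) (at t within I)"
proof -
  let ?F = "at t within I"
  let ?dq = "\<lambda>s z. (f z s - f z t) / of_real (s - t)"
  have F: "?F \<noteq> bot" using I(3) by (simp add: trivial_limit_within)
  have ul: "uniform_limit (cball 0 1) ?dq (\<lambda>z. ft z t) ?F"
    by (rule uniform_limit_time_difference_quotient[OF I(1,2) compact_cball der cont])
  have holb: "(\<lambda>z. f z s) holomorphic_on cball 0 1" if "s \<in> I" for s
    using hol[OF that] by (rule analytic_imp_holomorphic)
  have holq: "?dq s holomorphic_on cball 0 1" if "s \<in> I" for s
    unfolding divide_inverse by (intro holomorphic_intros holb that I)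
  have evI: "\<forall>\<^sub>F s in ?F. s \<in> I \<and> s \<noteq> t" by (auto simp: eventually_at_filter)
  show "(\<lambda>z. ft z t) holomorphic_on ball 0 1"
    by (rule holomorphic_uniform_limit[OF _ ul F])
       (auto intro!: eventually_mono[OF evI] holomorphic_on_imp_continuous_on holq holomorphic_on_subset[OF holq] simp del: of_real_diff)
  assume z: "z \<in> ball 0 1"
  have "((\<lambda>s. (deriv ^^ k) (?dq s) z) \<longlongrightarrow> (deriv ^^ k) (\<lambda>z. ft z t) z) ?F"
    by (rule higher_deriv_complex_uniform_limit[OF uniform_limit_on_subset[OF ul ball_subset_cball]])
       (use z F in \<open>auto intro!: eventually_mono[OF evI] holomorphic_on_subset[OF holq] simp del: of_real_diff\<close>)
  moreover have "(deriv ^^ k) (?dq s) z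
      = ((deriv ^^ k) (\<lambda>z. f z s) z - (deriv ^^ k) (\<lambda>z. f z t) z) / of_real (s - t)" if "s \<in> I" for s
  proof -
    have hb: "(\<lambda>z. f z s) holomorphic_on ball 0 1" if "s \<in> I" for s
      using holomorphic_on_subset[OF holb[OF that] ball_subset_cball] .
    have "(deriv ^^ k) (\<lambda>z. inverse (of_real (s - t)) * (f z s - f z t)) z
        = inverse (of_real (s - t)) * (deriv ^^ k) (\<lambda>z. f z s - f z t) z"
      by (rule higher_deriv_cmult[where A = "ball 0 1"]) (auto intro!: holomorphic_intros hb that I z[simplified])
    also have "(deriv ^^ k) (\<lambda>z. f z s - f z t) z
        = (deriv ^^ k) (\<lambda>z. f z s) z - (deriv ^^ k) (\<lambda>z. f z t) z"
      by (rule higher_deriv_diff[where S = "ball 0 1"]) (auto intro!: hb that I z[simplified])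
    finally show ?thesis by (simp add: divide_inverse mult.commute)
  qed
  then have "\<forall>\<^sub>F s in ?F. (deriv ^^ k) (?dq s) z
      = ((deriv ^^ k) (\<lambda>z. f z s) z - (deriv ^^ k) (\<lambda>z. f z t) z) / of_real (s - t)"
    by (intro eventually_mono[OF evI]) blast
  ultimately show "((\<lambda>s. (deriv ^^ k) (\<lambda>z. f z s) z) has_vector_derivative
           (deriv ^^ k) (\<lambda>z. ft z t) z) ?F"
    unfolding has_vector_derivative_iff_difference_quotient by (rule Lim_transform_eventually)
qed

section \<open>The Schwarz integral\<close>

text \<open>The integral of \<open>PG_Poisson\<close> with the density as a parameter, so that the
  estimates and the inversion formula can be proved for arbitrary continuous densities.\<close>

definition schwarz_integral :: "(complex \<Rightarrow> real) \<Rightarrow> complex \<Rightarrow> complex" where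
  "schwarz_integral u \<zeta> = 1 / (2 * of_real pi * \<i>) *
     contour_integral (circlepath 0 1) (\<lambda>z. of_real (u z) * ((z + \<zeta>) / (z - \<zeta>)) / z)"

text \<open>With integrand \<open>h z / z\<close> the contour integral is
  \<open>2 * of_real pi * \<i>\<close> times the mean of \<open>h\<close> over the angle, and a mean
  commutes with conjugation.\<close>

lemma has_contour_integral_circlepath_cnj:
  assumes "((\<lambda>z. h z / z) has_contour_integral 2 * of_real pi * \<i> * c) (circlepath 0 1)"
  shows "((\<lambda>z. cnj (h z) / z) has_contour_integral 2 * of_real pi * \<i> * cnj c) (circlepath 0 1)"
proof -
  have *: "((\<lambda>z. h z / z) has_contour_integral 2 * of_real pi * \<i> * c) (circlepath 0 1) \<longleftrightarrow>
     ((\<lambda>x. h (exp (2 * of_real pi * \<i> * of_real x))) has_integral c) {0..1}" for h c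
  proof -
    have "((\<lambda>z. h z / z) has_contour_integral 2 * of_real pi * \<i> * c) (circlepath 0 1) \<longleftrightarrow>
      ((\<lambda>x. (2 * of_real pi * \<i>) * h (exp (2 * of_real pi * \<i> * of_real x))) has_integral 
         (2 * of_real pi * \<i>) * c) {0..1}"
      unfolding has_contour_integral
      by (intro has_integral_cong) (simp add: vector_derivative_circlepath vector_derivative_circlepath01, simp add: circlepath mult_ac)
    then show ?thesis by (simp add: has_integral_mult_right_iff)
  qed
  have "(cnj \<circ> (\<lambda>x. h (exp (2 * of_real pi * \<i> * of_real x))) has_integral cnj c) {0..1}"
    using assms unfolding * has_integral_cnj .
  then show ?thesis unfolding * by (simp add: o_def)
qed

lemma schwarz_kernel_has_contour_integral:
  assumes "continuous_on (sphere 0 1) u" "\<zeta> \<in> ball 0 1"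
  shows "((\<lambda>z. of_real (u z) * ((z + \<zeta>) / (z - \<zeta>)) / z) has_contour_integral
          2 * of_real pi * \<i> * schwarz_integral u \<zeta>) (circlepath 0 1)"
proof -
  have "continuous_on (path_image (circlepath 0 1)) (\<lambda>z. of_real (u z) * ((z + \<zeta>) / (z - \<zeta>)) / z)"
    using assms by (auto intro!: continuous_intros)
  from has_contour_integral_integral[OF contour_integrable_continuous_circlepath[OF this]]
  show ?thesis by (simp add: schwarz_integral_def)
qed

lemma schwarz_integral_bound:
  assumes u: "continuous_on (sphere 0 1) u" "\<And>z. norm z = 1 \<Longrightarrow> \<bar>u z\<bar> \<le> B"
    and \<zeta>: "norm \<zeta> \<le> r" "r < 1" and "0 \<le> B"
  shows "norm (schwarz_integral u \<zeta>) \<le> B * (2 / (1 - r))"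
proof -
  have "norm (2 * of_real pi * \<i> * schwarz_integral u \<zeta>) \<le> B * (2 / (1 - r)) * (2 * pi * 1)"
  proof (rule has_contour_integral_bound_circlepath[OF schwarz_kernel_has_contour_integral[OF u(1)]])
    fix z :: complex assume "norm (z - 0) = 1"
    then have z: "norm z = 1" by simp
    have "norm (z + \<zeta>) \<le> 2" using norm_triangle_ineq[of z \<zeta>] z \<zeta> by simp
    moreover have "1 - r \<le> norm (z - \<zeta>)" using norm_triangle_ineq2[of z \<zeta>] z \<zeta> by simp
    ultimately have "norm (z + \<zeta>) / norm (z - \<zeta>) \<le> 2 / (1 - r)"
      using \<zeta> by (intro frac_le) auto
    then have "\<bar>u z\<bar> * (norm (z + \<zeta>) / norm (z - \<zeta>)) \<le> B * (2 / (1 - r))"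
      using u(2)[OF z] \<open>0 \<le> B\<close> by (intro mult_mono) auto
    then show "norm (of_real (u z) * ((z + \<zeta>) / (z - \<zeta>)) / z) \<le> B * (2 / (1 - r))"
      using z by (simp add: norm_mult norm_divide)
  qed (use \<zeta> \<open>0 \<le> B\<close> in auto)
  then have "norm (schwarz_integral u \<zeta>) * (2 * pi) \<le> (B * (2 / (1 - r))) * (2 * pi)"
    by (simp add: norm_mult mult_ac)
  then show ?thesis by (rule mult_right_le_imp_le) simp
qed

lemma schwarz_integral_lipschitz:
  assumes u: "continuous_on (sphere 0 1) u" "\<And>z. norm z = 1 \<Longrightarrow> \<bar>u z\<bar> \<le> B"
    and \<zeta>: "norm \<zeta> \<le> r" "norm \<xi> \<le> r" "r < 1" and "0 \<le> B"
  shows "norm (schwarz_integral u \<zeta> - schwarz_integral u \<xi>) \<le> B * (2 / (1 - r)\<^sup>2) * norm (\<zeta> - \<xi>)"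
proof -
  let ?C = "B * (2 / (1 - r)\<^sup>2) * norm (\<zeta> - \<xi>)"
  have "norm (2 * of_real pi * \<i> * schwarz_integral u \<zeta> - 2 * of_real pi * \<i> * schwarz_integral u \<xi>)
      \<le> ?C * (2 * pi * 1)"
  proof (rule has_contour_integral_bound_circlepath[OF has_contour_integral_diff[OF
        schwarz_kernel_has_contour_integral[OF u(1)] schwarz_kernel_has_contour_integral[OF u(1)]]])
    fix z :: complex assume "norm (z - 0) = 1"
    then have z: "norm z = 1" by simp
    have 1: "1 - r \<le> norm (z - \<zeta>)" using norm_triangle_ineq2[of z \<zeta>] z \<zeta> by simp
    have 2: "1 - r \<le> norm (z - \<xi>)" using norm_triangle_ineq2[of z \<xi>] z \<zeta> by simp
    have nz: "z \<noteq> 0" "z - \<zeta> \<noteq> 0" "z - \<xi> \<noteq> 0" using 1 2 z \<zeta> by auto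
    \<comment> \<open>Subtracting the kernels produces a factor \<open>z\<close> that cancels the
      division by \<open>z\<close>; what remains is controlled by the distances of \<open>z\<close>
      to \<open>\<zeta>\<close> and \<open>\<xi>\<close>.\<close>
    have "of_real (u z) * ((z + \<zeta>) / (z - \<zeta>)) / z - of_real (u z) * ((z + \<xi>) / (z - \<xi>)) / z
        = of_real (u z) * (2 * (\<zeta> - \<xi>) / ((z - \<zeta>) * (z - \<xi>)))"
      using nz by (simp add: divide_simps) (simp add: algebra_simps)
    then have "norm (of_real (u z) * ((z + \<zeta>) / (z - \<zeta>)) / z - of_real (u z) * ((z + \<xi>) / (z - \<xi>)) / z)
        = \<bar>u z\<bar> * (2 * norm (\<zeta> - \<xi>) / (norm (z - \<zeta>) * norm (z - \<xi>)))"
      by (simp only: norm_mult norm_divide norm_of_real norm_numeral)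
    also have "\<dots> \<le> B * (2 * norm (\<zeta> - \<xi>) / ((1 - r) * (1 - r)))"
      using u(2)[OF z] \<open>0 \<le> B\<close> 1 2 \<zeta>
      by (intro mult_mono divide_left_mono mult_pos_pos) (auto intro!: mult_pos_pos)
    finally show "norm (of_real (u z) * ((z + \<zeta>) / (z - \<zeta>)) / z - of_real (u z) * ((z + \<xi>) / (z - \<xi>)) / z) \<le> ?C"
      by (simp add: power2_eq_square mult_ac)
  qed (use \<zeta> \<open>0 \<le> B\<close> in auto)
  then have "norm (2 * of_real pi * \<i> * (schwarz_integral u \<zeta> - schwarz_integral u \<xi>)) \<le> ?C * (2 * pi)"
    by (simp only: right_diff_distrib mult_1_right)
  then have "norm (schwarz_integral u \<zeta> - schwarz_integral u \<xi>) * (2 * pi) \<le> ?C * (2 * pi)"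
    by (simp only: norm_mult norm_of_real norm_numeral norm_ii mult_1_right abs_of_pos[OF pi_gt_zero]
      mult.commute[of _ "2 * pi"])
  then show ?thesis by (rule mult_right_le_imp_le) simp
qed

text \<open>Split \<open>Re (p z)\<close> into half of \<open>p\<close> plus its conjugate. The
  kernel divided by \<open>z\<close> is \<open>2 / (z - \<zeta>) - 1 / z\<close>, so Cauchy's
  formula turns the part with \<open>p\<close> into \<open>2 * p \<zeta> - p 0\<close>. The
  conjugate part gives \<open>cnj (p 0)\<close>, which cancels \<open>p 0\<close> because
  \<open>p 0\<close> is real.\<close>

lemma schwarz_formula:
  assumes cont: "continuous_on (cball 0 1) p" and hol: "p holomorphic_on ball 0 1"
    and im: "Im (p 0) = 0" and \<zeta>: "\<zeta> \<in> ball 0 1"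
  shows "schwarz_integral (\<lambda>z. Re (p z)) \<zeta> = p \<zeta>"
proof -
  let ?k = "\<lambda>z. (z + \<zeta>) / (z - \<zeta>)" and ?c = "2 * of_real pi * \<i>"
  have nz: "z \<noteq> 0" "z - \<zeta> \<noteq> 0" "1 - cnj \<zeta> * z \<noteq> 0" if "norm z = 1" for z
  proof -
    have "norm (cnj \<zeta> * z) < 1" using \<zeta> that by (simp add: norm_mult)
    then have "cnj \<zeta> * z \<noteq> 1" by force
    then show "1 - cnj \<zeta> * z \<noteq> 0" by simp
  qed (use \<zeta> that in auto)
  have C: "((\<lambda>u. p u / (u - \<zeta>)) has_contour_integral ?c * p \<zeta>) (circlepath 0 1)"
    "((\<lambda>u. p u / (u - 0)) has_contour_integral ?c * p 0) (circlepath 0 1)"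
    using \<zeta> by (intro Cauchy_integral_circlepath[OF cont hol]; simp)+
  have "((\<lambda>u. 2 * (p u / (u - \<zeta>)) - p u / (u - 0)) has_contour_integral 2 * (?c * p \<zeta>) - ?c * p 0) (circlepath 0 1)"
    by (intro has_contour_integral_diff has_contour_integral_lmul C)
  then have 1: "((\<lambda>z. p z * ?k z / z) has_contour_integral 2 * (?c * p \<zeta>) - ?c * p 0) (circlepath 0 1)"
  proof (rule has_contour_integral_eq)
    fix z assume "z \<in> path_image (circlepath 0 1)"
    then have "z \<noteq> 0" "z \<noteq> \<zeta>" using nz[of z] by auto
    then show "2 * (p z / (z - \<zeta>)) - p z / (z - 0) = p z * ?k z / z"
      by (simp add: divide_simps) (simp add: algebra_simps)
  qed
  have nzb: "1 - cnj \<zeta> * z \<noteq> 0" if "norm z \<le> 1" for z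
  proof -
    have "norm (cnj \<zeta> * z) \<le> norm \<zeta> * 1" unfolding norm_mult using that by (intro mult_mono) auto
    with \<zeta> have "norm (cnj \<zeta> * z) < 1" by simp
    then have "cnj \<zeta> * z \<noteq> 1" by force
    then show ?thesis by simp
  qed
  \<comment> \<open>On the circle \<open>cnj z = 1 / z\<close>, so conjugating the second factor of
    \<open>?h\<close> gives the kernel \<open>?k\<close>. Since \<open>?h\<close> is holomorphic in
    the disc, Cauchy's formula at 0 evaluates its mean.\<close>
  let ?h = "\<lambda>z. p z * ((1 + cnj \<zeta> * z) / (1 - cnj \<zeta> * z))"
  have "((\<lambda>u. ?h u / (u - 0)) has_contour_integral ?c * ?h 0) (circlepath 0 1)"
  proof (rule Cauchy_integral_circlepath)
    show "continuous_on (cball 0 1) ?h"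
      using nzb by (intro continuous_intros cont) (simp del: right_minus_eq)
    show "?h holomorphic_on ball 0 1"
      using nzb by (intro holomorphic_intros hol) (simp del: right_minus_eq)
  qed simp
  then have "((\<lambda>z. cnj (?h z) / z) has_contour_integral ?c * cnj (p 0)) (circlepath 0 1)"
    using has_contour_integral_circlepath_cnj[of ?h "p 0"] by simp
  then have 2: "((\<lambda>z. cnj (p z) * ?k z / z) has_contour_integral ?c * cnj (p 0)) (circlepath 0 1)"
  proof (rule has_contour_integral_eq)
    fix z assume "z \<in> path_image (circlepath 0 1)"
    then have z: "norm z = 1" by simp
    then have "z * cnj z = 1" by (simp add: complex_norm_square[symmetric])
    then have cz: "cnj z = 1 / z" using nz[OF z] by (simp add: field_simps)
    have "cnj ((1 + cnj \<zeta> * z) / (1 - cnj \<zeta> * z)) = ?k z"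
      using nz[OF z] by (simp add: cz divide_simps)
    then show "cnj (?h z) / z = cnj (p z) * ?k z / z" by (simp only: complex_cnj_mult)
  qed
  have "cnj (p 0) = p 0" using im by (simp add: complex_eq_iff)
  then have "((\<lambda>z. (1 / 2) * (p z * ?k z / z + cnj (p z) * ?k z / z)) has_contour_integral
      (1 / 2) * (2 * (?c * p \<zeta>) - ?c * p 0 + ?c * p 0)) (circlepath 0 1)"
    using has_contour_integral_lmul[OF has_contour_integral_add[OF 1 2], of "1/2"] by simp
  moreover have "(1 / 2) * (p z * ?k z / z + cnj (p z) * ?k z / z) = of_real (Re (p z)) * ?k z / z" for z
  proof -
    have "of_real (Re (p z)) = (1 / 2) * (p z + cnj (p z))" by (simp add: complex_add_cnj)
    then show ?thesis by (simp only: add_divide_distrib distrib_right distrib_left times_divide_eq_right mult.assoc add_ac)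
  qed
  moreover have "(1 / 2) * (2 * (?c * p \<zeta>) - ?c * p 0 + ?c * p 0) = ?c * p \<zeta>" by simp
  ultimately have "((\<lambda>z. of_real (Re (p z)) * ?k z / z) has_contour_integral ?c * p \<zeta>) (circlepath 0 1)"
    by (simp only:)
  then have "contour_integral (circlepath 0 1) (\<lambda>z. of_real (Re (p z)) * ?k z / z) = ?c * p \<zeta>"
    by (rule contour_integral_unique)
  then show ?thesis by (simp add: schwarz_integral_def)
qed

section \<open>Motion of simple poles\<close>

text \<open>The weights \<open>c\<close> depend on the nodes and on \<open>w\<close> but not on
  \<open>p\<close>. Hence convergence at the nodes implies convergence at \<open>w\<close> for a
  whole family of polynomials of bounded degree.\<close>

lemma lagrange_interpolation:
  fixes S :: "'a::field set"
  assumes S: "finite S"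
  obtains c where "\<And>p. degree p < card S \<Longrightarrow> poly p w = (\<Sum>u\<in>S. c u * poly p u)"
proof
  let ?c = "\<lambda>u. \<Prod>v\<in>S - {u}. (w - v) / (u - v)"
  let ?L = "\<lambda>u. \<Prod>v\<in>S - {u}. smult (1 / (u - v)) [:- v, 1:]"
  fix p :: "'a poly" assume deg: "degree p < card S"
  let ?r = "\<Sum>u\<in>S. smult (poly p u) (?L u)"
  have L: "poly (?L u) x = (\<Prod>v\<in>S - {u}. (x - v) / (u - v))" for u x
    by (simp add: poly_prod add_divide_distrib[symmetric] diff_divide_distrib[symmetric])
  have "degree (?L u) < card S" if "u \<in> S" for u
  proof -
    have "degree (?L u) \<le> (\<Sum>v\<in>S - {u}. degree (smult (1 / (u - v)) [:- v, 1:]))"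
      using S by (intro degree_prod_sum_le[unfolded o_def]) auto
    also have "\<dots> \<le> (\<Sum>v\<in>S - {u}. 1)"
      by (intro sum_mono order_trans[OF degree_smult_le]) simp
    also have "\<dots> < card S" using that S card_gt_0_iff[of S] by auto
    finally show ?thesis .
  qed
  then have "degree ?r < card S"
    using S deg by (intro le_less_trans[OF degree_sum_le[where n = "card S - 1"]])
      (auto intro!: order_trans[OF degree_smult_le] simp: less_Suc_eq_le[symmetric] dest: Suc_pred)
  moreover have "poly p x = poly ?r x" if x: "x \<in> S" for x
  proof -
    have "poly ?r x = (\<Sum>u\<in>S. if u = x then poly p x else 0)"
      unfolding poly_sum poly_smult L
    proof (intro sum.cong refl)
      fix u assume "u \<in> S"
      show "poly p u * (\<Prod>v\<in>S - {u}. (x - v) / (u - v)) = (if u = x then poly p x else 0)"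
        using x S by (auto intro!: prod.neutral prod_zero)
    qed
    then show ?thesis using x S by simp
  qed
  ultimately have "p = ?r" using deg by (intro poly_eqI_degree[of S]) auto
  then have "poly p w = (\<Sum>u\<in>S. poly p u * ?c u)"
    by (metis (no_types, lifting) L poly_smult poly_sum sum.cong)
  then show "poly p w = (\<Sum>u\<in>S. ?c u * poly p u)" by (simp add: mult.commute)
qed

text \<open>The derivative of the sum is known only in the disc, which contains none of the poles.
  That the number of poles is finite and the residues are constant in time is what carries this
  information out to the poles.\<close>

lemma simple_poles_differentiable:
  fixes a :: "'i \<Rightarrow> real \<Rightarrow> complex" and \<rho> :: "'i \<Rightarrow> complex"
  assumes X: "finite X" and t: "t islimpt I"
    and cont: "\<And>x. x \<in> X \<Longrightarrow> (a x \<longlongrightarrow> a x t) (at t within I)"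
    and inj: "inj_on (\<lambda>x. a x t) X"
    and \<rho>: "\<And>x. x \<in> X \<Longrightarrow> \<rho> x \<noteq> 0"
    and out: "\<And>x. x \<in> X \<Longrightarrow> norm (a x t) > 1"
    and der: "\<And>z. z \<in> ball 0 1 \<Longrightarrow>
      ((\<lambda>s. \<Sum>x\<in>X. \<rho> x / (z - a x s)) has_vector_derivative D z) (at t within I)"
  obtains v where "\<And>x. x \<in> X \<Longrightarrow> (a x has_vector_derivative v x) (at t within I)"
    and "\<And>z. z \<in> ball 0 1 \<Longrightarrow> D z = (\<Sum>x\<in>X. \<rho> x * v x / (z - a x t)\<^sup>2)"
proof -
  let ?F = "at t within I"
  define \<delta> where "\<delta> x s = (a x s - a x t) / of_real (s - t)" for x s
  define Q where "Q x s z = (\<Prod>y\<in>X - {x}. z - a y s)" for x s z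
  \<comment> \<open>The numerator of the difference quotient: of bounded degree in \<open>z\<close>, so that convergence on the
    disc implies convergence everywhere; at \<open>z = a x t\<close> only the summand of \<open>x\<close> survives.\<close>
  define R where "R s = (\<Sum>x\<in>X. smult (\<rho> x * \<delta> x s)
      ((\<Prod>y\<in>X - {x}. [:- a y s, 1:]) * (\<Prod>y\<in>X - {x}. [:- a y t, 1:])))" for s
  have polyR: "poly (R s) z = (\<Sum>x\<in>X. \<rho> x * \<delta> x s * (Q x s z * Q x t z))" for s z
    by (simp add: R_def Q_def poly_sum poly_prod)
  have degR: "degree (R s) \<le> card X + card X" for s
  proof -
    have "degree (\<Prod>y\<in>X - {x}. [:- a y s, 1:]) \<le> card X" for x s
    proof -
      have "degree (\<Prod>y\<in>X - {x}. [:- a y s, 1:]) \<le> (\<Sum>y\<in>X - {x}. degree [:- a y s, 1:])"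
        using X by (intro degree_prod_sum_le[unfolded o_def]) auto
      also have "\<dots> \<le> card X" using X by (simp add: card_mono)
      finally show ?thesis .
    qed
    then show ?thesis unfolding R_def
      by (intro degree_sum_le X order_trans[OF degree_smult_le] order_trans[OF degree_mult_le] add_mono)
  qed
  have evout: "\<forall>\<^sub>F s in ?F. \<forall>x\<in>X. norm (a x s) > 1"
    using X by (intro eventually_ball_finite ballI order_tendstoD(1)[OF tendsto_norm[OF cont]] out) auto
  have ev: "\<forall>\<^sub>F s in ?F. s \<noteq> t \<and> (\<forall>x\<in>X. norm (a x s) > 1)"
    using evout by (simp add: eventually_at_filter)
  have quot: "(1 / (z - a x s) - 1 / (z - a x t)) / of_real (s - t) = \<delta> x s / ((z - a x s) * (z - a x t))"
    if "z \<in> ball 0 1" "x \<in> X" "\<forall>x\<in>X. norm (a x s) > 1" "s \<noteq> t" for x s z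
  proof -
    have "z - a x s \<noteq> 0" "z - a x t \<noteq> 0" "of_real (s - t) \<noteq> (0::complex)" using that out[of x] by auto
    then show ?thesis unfolding \<delta>_def by (simp add: divide_simps del: of_real_diff)
  qed
  have sumquot: "((\<Sum>x\<in>X. \<rho> x / (z - a x s)) - (\<Sum>x\<in>X. \<rho> x / (z - a x t))) / of_real (s - t)
      = (\<Sum>x\<in>X. \<rho> x * \<delta> x s / ((z - a x s) * (z - a x t)))"
    if "z \<in> ball 0 1" "\<forall>x\<in>X. norm (a x s) > 1" "s \<noteq> t" for s z
  proof -
    have "((\<Sum>x\<in>X. \<rho> x / (z - a x s)) - (\<Sum>x\<in>X. \<rho> x / (z - a x t))) / of_real (s - t)
       = (\<Sum>x\<in>X. \<rho> x * ((1 / (z - a x s) - 1 / (z - a x t)) / of_real (s - t)))"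
      by (simp add: sum_subtractf[symmetric] sum_divide_distrib right_diff_distrib)
    also have "\<dots> = (\<Sum>x\<in>X. \<rho> x * \<delta> x s / ((z - a x s) * (z - a x t)))"
      by (intro sum.cong refl) (simp only: quot[OF that(1) _ that(2,3)] times_divide_eq_right)
    finally show ?thesis .
  qed
  have limR_ball: "((\<lambda>s. poly (R s) z) \<longlongrightarrow> D z * ((\<Prod>x\<in>X. z - a x t) * (\<Prod>x\<in>X. z - a x t))) ?F"
    if z: "z \<in> ball 0 1" for z
  proof -
    have "((\<lambda>s. ((\<Sum>x\<in>X. \<rho> x / (z - a x s)) - (\<Sum>x\<in>X. \<rho> x / (z - a x t))) / of_real (s - t)
        * ((\<Prod>x\<in>X. z - a x s) * (\<Prod>x\<in>X. z - a x t)))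
      \<longlongrightarrow> D z * ((\<Prod>x\<in>X. z - a x t) * (\<Prod>x\<in>X. z - a x t))) ?F"
      by (intro tendsto_mult tendsto_prod tendsto_const tendsto_diff cont
          der[OF z, unfolded has_vector_derivative_iff_difference_quotient])
    moreover have "\<forall>\<^sub>F s in ?F. ((\<Sum>x\<in>X. \<rho> x / (z - a x s)) - (\<Sum>x\<in>X. \<rho> x / (z - a x t))) / of_real (s - t)
        * ((\<Prod>x\<in>X. z - a x s) * (\<Prod>x\<in>X. z - a x t)) = poly (R s) z"
      using ev
    proof eventually_elim
      case (elim s)
      have "\<rho> x * \<delta> x s / ((z - a x s) * (z - a x t)) * ((\<Prod>x\<in>X. z - a x s) * (\<Prod>x\<in>X. z - a x t))
          = \<rho> x * \<delta> x s * (Q x s z * Q x t z)" if x: "x \<in> X" for x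
      proof -
        have "(\<Prod>x\<in>X. z - a x r) = (z - a x r) * Q x r z" for r
          unfolding Q_def using X x by (simp add: prod.remove)
        moreover have "z - a x s \<noteq> 0" "z - a x t \<noteq> 0" using elim out[OF x] x z by auto
        ultimately show ?thesis by (simp add: divide_simps)
      qed
      then show ?case unfolding polyR sumquot[OF z conjunct2[OF elim] conjunct1[OF elim]] sum_distrib_right
        by (rule sum.cong[OF refl])
    qed
    ultimately show ?thesis by (rule Lim_transform_eventually)
  qed
  have limR: "\<exists>l. ((\<lambda>s. poly (R s) w) \<longlongrightarrow> l) ?F" for w
  proof -
    have "infinite (ball (0::complex) 1)" by (simp add: uncountable_ball uncountable_infinite)
    \<comment> \<open>One node more than the degree bound \<open>degR\<close>.\<close>
    then obtain S where S: "S \<subseteq> ball (0::complex) 1" "finite S" "card S = Suc (card X + card X)"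
      using infinite_arbitrarily_large by metis
    obtain c where c: "\<And>p. degree p < card S \<Longrightarrow> poly p w = (\<Sum>u\<in>S. c u * poly p u)"
      using lagrange_interpolation[OF S(2), of w] by blast
    have "poly (R s) w = (\<Sum>u\<in>S. c u * poly (R s) u)" for s
      by (rule c) (use degR[of s] S in simp)
    moreover have "((\<lambda>s. \<Sum>u\<in>S. c u * poly (R s) u) \<longlongrightarrow>
        (\<Sum>u\<in>S. c u * (D u * ((\<Prod>x\<in>X. u - a x t) * (\<Prod>x\<in>X. u - a x t))))) ?F"
      by (intro tendsto_sum tendsto_mult tendsto_const limR_ball) (use S in auto)
    ultimately show ?thesis by auto
  qed
  have "\<exists>v. (\<delta> x \<longlongrightarrow> v) ?F" if x: "x \<in> X" for x
  proof -
    obtain l where l: "((\<lambda>s. poly (R s) (a x t)) \<longlongrightarrow> l) ?F" using limR by blast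
    have nz: "Q x t (a x t) \<noteq> 0" unfolding Q_def using X inj x by (auto simp: inj_on_def)
    have Qlim: "((\<lambda>s. Q x s (a x t)) \<longlongrightarrow> Q x t (a x t)) ?F"
      unfolding Q_def by (intro tendsto_prod tendsto_diff tendsto_const cont) auto
    have eq: "poly (R s) (a x t) = \<rho> x * \<delta> x s * (Q x s (a x t) * Q x t (a x t))" for s
    proof -
      have "Q y t (a x t) = 0" if "y \<in> X - {x}" for y
        unfolding Q_def using X x that by (intro prod_zero) auto
      then show ?thesis unfolding polyR using X x by (simp add: sum.remove)
    qed
    \<comment> \<open>By continuity and distinctness of the poles, the cofactor
      \<open>Q x s (a x t)\<close> has a nonzero limit, so dividing by it isolates
      \<open>\<delta> x s\<close>.\<close>
    have "((\<lambda>s. poly (R s) (a x t) / (\<rho> x * (Q x s (a x t) * Q x t (a x t)))) \<longlongrightarrow>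
        l / (\<rho> x * (Q x t (a x t) * Q x t (a x t)))) ?F"
      using nz \<rho>[OF x] by (intro tendsto_intros l Qlim) auto
    moreover have "\<forall>\<^sub>F s in ?F. poly (R s) (a x t) / (\<rho> x * (Q x s (a x t) * Q x t (a x t))) = \<delta> x s"
      using tendsto_imp_eventually_ne[OF Qlim nz] by eventually_elim (simp add: eq nz \<rho>[OF x])
    ultimately show ?thesis using Lim_transform_eventually by blast
  qed
  then obtain v where v: "\<And>x. x \<in> X \<Longrightarrow> (\<delta> x \<longlongrightarrow> v x) ?F" by metis
  show thesis
  proof
    show "(a x has_vector_derivative v x) ?F" if "x \<in> X" for x
      unfolding has_vector_derivative_iff_difference_quotient
      using v[OF that] unfolding \<delta>_def .
    show "D z = (\<Sum>x\<in>X. \<rho> x * v x / (z - a x t)\<^sup>2)" if z: "z \<in> ball 0 1" for z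
    proof (rule tendsto_unique)
      show "?F \<noteq> bot" using t by (simp add: trivial_limit_within)
      show "((\<lambda>s. ((\<Sum>x\<in>X. \<rho> x / (z - a x s)) - (\<Sum>x\<in>X. \<rho> x / (z - a x t))) / of_real (s - t)) \<longlongrightarrow> D z) ?F"
        using der[OF z] unfolding has_vector_derivative_iff_difference_quotient .
      have "((\<lambda>s. \<Sum>x\<in>X. \<rho> x * \<delta> x s / ((z - a x s) * (z - a x t))) \<longlongrightarrow>
          (\<Sum>x\<in>X. \<rho> x * v x / ((z - a x t) * (z - a x t)))) ?F"
        using z out by (intro tendsto_sum tendsto_divide tendsto_mult tendsto_diff tendsto_const cont v) force+
      then have "((\<lambda>s. ((\<Sum>x\<in>X. \<rho> x / (z - a x s)) - (\<Sum>x\<in>X. \<rho> x / (z - a x t))) / of_real (s - t)) \<longlongrightarrow>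
          (\<Sum>x\<in>X. \<rho> x * v x / ((z - a x t) * (z - a x t)))) ?F"
        by (rule Lim_transform_eventually) (use ev in eventually_elim, simp add: sumquot[OF z] del: of_real_diff)
      then show "((\<lambda>s. ((\<Sum>x\<in>X. \<rho> x / (z - a x s)) - (\<Sum>x\<in>X. \<rho> x / (z - a x t))) / of_real (s - t)) \<longlongrightarrow>
          (\<Sum>x\<in>X. \<rho> x * v x / (z - a x t)\<^sup>2)) ?F" by (simp add: power2_eq_square)
    qed
  qed
qed

section \<open>Continuation of the potential across the circle\<close>

text \<open>Division by \<open>z * g z\<close> is harmless because \<open>F\<close> vanishes at 0
  and \<open>g\<close> nowhere in the closed disc. On the circle \<open>z * cnj z = 1\<close> turns
  \<open>Fq\<close> into a prescription of \<open>Re (p z)\<close>, and the Schwarz formula recovers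
  \<open>p\<close>; \<open>im\<close> says that \<open>p 0\<close> is real, which fixes the free
  imaginary constant.\<close>

lemma PG_potential_factorization:
  assumes Fcont: "continuous_on (cball 0 1) F" and Fhol: "F holomorphic_on ball 0 1" and F0: "F 0 = 0"
    and gcont: "continuous_on (cball 0 1) g" and ghol: "g holomorphic_on ball 0 1"
    and gnz: "\<And>z. norm z \<le> 1 \<Longrightarrow> g z \<noteq> 0"
    and Fq: "\<And>z. norm z = 1 \<Longrightarrow> Re (F z * cnj (z * g z)) = q"
    and im: "Im (deriv F 0 / g 0) = 0"
  obtains p where "continuous_on (cball 0 1) p" "p holomorphic_on ball 0 1"
    "\<And>z. norm z \<le> 1 \<Longrightarrow> F z = z * g z * p z"
    "\<And>z. norm z = 1 \<Longrightarrow> Re (p z) = q / (norm (g z))\<^sup>2"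
    "\<And>z. norm z < 1 \<Longrightarrow> p z = schwarz_integral (\<lambda>z. q / (norm (g z))\<^sup>2) z"
proof -
  define r where "r z = (if z = 0 then deriv F 0 else F z / z)" for z
  define p where "p z = r z / g z" for z
  have rhol: "r holomorphic_on ball 0 1"
    using pole_lemma[OF Fhol, of 0] by (simp add: r_def[abs_def] F0 cong: if_cong)
  have "continuous_on (cball 0 (1/2) \<union> (cball 0 1 - ball 0 (1/2))) r"
  proof (rule continuous_on_closed_Un)
    show "continuous_on (cball 0 (1/2)) r"
      by (rule continuous_on_subset[OF holomorphic_on_imp_continuous_on[OF rhol]]) auto
    have "continuous_on (cball 0 1 - ball 0 (1/2)) (\<lambda>z. F z / z)"
      by (intro continuous_intros continuous_on_subset[OF Fcont]) auto
    then show "continuous_on (cball 0 1 - ball 0 (1/2)) r"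
      by (rule continuous_on_eq) (auto simp: r_def)
  qed auto
  moreover have "cball 0 (1/2) \<union> (cball 0 1 - ball 0 (1/2)) = cball (0::complex) 1" by auto
  ultimately have rcont: "continuous_on (cball 0 1) r" by simp
  have pcont: "continuous_on (cball 0 1) p" unfolding p_def
    by (intro continuous_intros rcont gcont) (use gnz in auto)
  have phol: "p holomorphic_on ball 0 1" unfolding p_def
    by (intro holomorphic_intros rhol ghol) (use gnz in auto)
  have Fp: "F z = z * g z * p z" if "norm z \<le> 1" for z
    using gnz[OF that] F0 by (simp add: p_def r_def)
  have Rep: "Re (p z) = q / (norm (g z))\<^sup>2" if z: "norm z = 1" for z
  proof -
    have "z * cnj z = 1" using z by (simp add: complex_norm_square[symmetric])
    then have "F z * cnj (z * g z) = p z * (g z * cnj (g z))"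
      using Fp[of z] z by (simp add: mult_ac)
    also have "\<dots> = p z * of_real ((norm (g z))\<^sup>2)" by (simp only: complex_norm_square)
    finally have "q = Re (p z) * (norm (g z))\<^sup>2" using Fq[OF z] by (simp del: of_real_power)
    then show ?thesis using gnz[of z] z by simp
  qed
  have "p z = schwarz_integral (\<lambda>z. q / (norm (g z))\<^sup>2) z" if z: "norm z < 1" for z
  proof -
    have "p z = schwarz_integral (\<lambda>z. Re (p z)) z"
      using z im by (intro schwarz_formula[symmetric] pcont phol) (auto simp: p_def r_def)
    also have "\<dots> = schwarz_integral (\<lambda>z. q / (norm (g z))\<^sup>2) z"
      unfolding schwarz_integral_def by (intro arg_cong2[of _ _ _ _ "(*)"] refl contour_integral_cong) (auto simp: Rep)
    finally show ?thesis .
  qed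
  with pcont phol Fp Rep show thesis using that by blast
qed

section \<open>Reflection in the unit circle and pasting in the logarithmic coordinate\<close>

lemma reflect_has_field_derivative:
  assumes "(h has_field_derivative D) (at (1 / cnj z))" "z \<noteq> 0"
  shows "(reflect h has_field_derivative - cnj D / z\<^sup>2) (at z)"
proof -
  have "(h has_field_derivative D) (at (cnj (1 / z)))" using assms by simp
  from has_field_derivative_cnj_cnj[OF this]
  have 1: "((cnj \<circ> h \<circ> cnj) has_field_derivative cnj D) (at (1 / z))" .
  have 2: "((\<lambda>z. 1 / z) has_field_derivative - 1 / z\<^sup>2) (at z)"
    using assms(2) by (auto intro!: derivative_eq_intros simp: power2_eq_square)
  have "((cnj \<circ> h \<circ> cnj) \<circ> (\<lambda>z. 1 / z) has_field_derivative cnj D * (- 1 / z\<^sup>2)) (at z)"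
    by (rule DERIV_chain[OF 1 2])
  moreover have "(cnj \<circ> h \<circ> cnj) \<circ> (\<lambda>z. 1 / z) = reflect h"
    by (auto simp: reflect_def fun_eq_iff)
  ultimately show ?thesis by simp
qed

lemma reflect_holomorphic_on:
  assumes "h holomorphic_on ball 0 1"
  shows "reflect h holomorphic_on {z. norm z > 1}"
proof (rule holomorphic_onI)
  fix z :: complex assume "z \<in> {z. norm z > 1}"
  then have z: "z \<noteq> 0" "1 / cnj z \<in> ball 0 1" by (auto simp: norm_divide divide_less_eq)
  have "(h has_field_derivative deriv h (1 / cnj z)) (at (1 / cnj z))"
    using assms z by (intro holomorphic_derivI) auto
  from reflect_has_field_derivative[OF this z(1)]
  show "reflect h field_differentiable at z within {z. norm z > 1}"
    unfolding field_differentiable_def using has_field_derivative_at_within by metis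
qed

lemma reflect_continuous_on:
  assumes "continuous_on (cball 0 1) h"
  shows "continuous_on {z. norm z \<ge> 1} (reflect h)"
  unfolding reflect_def
  by (intro continuous_on_cnj continuous_on_compose2[OF assms] continuous_intros)
     (auto simp: norm_divide divide_le_eq)

lemma norm_eq_1_imp_inverse_cnj: "norm z = 1 \<Longrightarrow> 1 / cnj z = z"
proof -
  assume "norm z = 1"
  then have "z * cnj z = 1" by (simp add: complex_norm_square[symmetric])
  then show "1 / cnj z = z" by (auto simp: divide_eq_eq)
qed

text \<open>Finitely many points have countably many logarithms, and the plane without a countable
  set is connected. This lets the identity theorem act in the coordinate log z.\<close>

lemma exp_vimage_connected_open:
  assumes "finite Z" "0 \<notin> Z"
  shows "open {w. exp w \<notin> Z}" "connected {w::complex. exp w \<notin> Z}"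
proof -
  have "open (exp -` (- Z))"
    using assms by (intro open_vimage continuous_intros) (auto intro: finite_imp_closed)
  then show "open {w. exp w \<notin> Z}" by (simp add: vimage_def)
  have "countable {w. exp w = z}" if "z \<noteq> 0" for z :: complex
  proof -
    have "{w. exp w = z} \<subseteq> range (\<lambda>n::int. Ln z + (of_int (2 * n) * pi) * \<i>)"
      using exp_eq[of _ "Ln z"] that by (auto simp: image_iff)
    then show ?thesis by (rule countable_subset) auto
  qed
  note C = this
  have "countable (\<Union>z\<in>Z. {w. exp w = z})"
  proof (rule countable_UN[OF countable_finite[OF assms(1)]])
    show "countable {w. exp w = z}" if "z \<in> Z" for z
      by (rule C) (use that assms(2) in auto)
  qed
  then have "connected (UNIV - (\<Union>z\<in>Z. {w::complex. exp w = z}))"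
    by (intro connected_open_diff_countable) auto
  moreover have "UNIV - (\<Union>z\<in>Z. {w. exp w = z}) = {w. exp w \<notin> Z}" by auto
  ultimately show "connected {w::complex. exp w \<notin> Z}" by simp
qed

text \<open>Functions that are holomorphic on both sides of a line and match continuously on it form
  one holomorphic function. The identity theorem then spreads the formula for the derivative from
  the disc to the exterior.\<close>

lemma holomorphic_extension_across_circle:
  assumes Z: "finite Z" "\<And>z. z \<in> Z \<Longrightarrow> norm z > 1"
    and F: "continuous_on (cball 0 1) F" "F holomorphic_on ball 0 1"
    and E: "continuous_on ({z. norm z \<ge> 1} - Z) E" "E holomorphic_on {z. norm z > 1} - Z"
    and FE: "\<And>z. norm z = 1 \<Longrightarrow> F z = E z"
    and H: "H holomorphic_on - Z" "\<And>z. z \<in> ball 0 1 \<Longrightarrow> deriv F z = H z"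
    and z: "norm z > 1" "z \<notin> Z"
  shows "deriv E z = H z"
proof -
  define S where "S = {w::complex. exp w \<notin> Z}"
  have S: "open S" "connected S"
    unfolding S_def using exp_vimage_connected_open[OF Z(1)] Z(2)[of 0] by auto
  \<comment> \<open>In the coordinate \<open>w = log z\<close> the circle becomes the line \<open>Re w = 0\<close>.\<close>
  define \<Phi> where "\<Phi> w = (if Re w \<le> 0 then F (exp w) else E (exp w))" for w
  have expS: "exp ` S \<subseteq> - Z" by (auto simp: S_def)
  have oL: "open {w. Re w < 0}" "open {w. 0 < Re w}" by (simp_all add: open_halfspace_Re_lt open_halfspace_Re_gt)
  have hol1: "\<Phi> holomorphic_on S \<inter> {w. Re w < 0}"
  proof -
    have "F \<circ> exp holomorphic_on S \<inter> {w. Re w < 0}"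
      by (intro holomorphic_on_compose_gen[OF _ F(2)] holomorphic_intros) auto
    then show ?thesis by (rule holomorphic_transform) (auto simp: \<Phi>_def)
  qed
  have hol2: "\<Phi> holomorphic_on S \<inter> {w. 0 < Re w}"
  proof -
    have "E \<circ> exp holomorphic_on S \<inter> {w. 0 < Re w}"
      by (intro holomorphic_on_compose_gen[OF _ E(2)] holomorphic_intros) (auto simp: S_def)
    then show ?thesis by (rule holomorphic_transform) (auto simp: \<Phi>_def)
  qed
  have cont: "continuous_on S \<Phi>"
    unfolding \<Phi>_def
  proof (rule continuous_on_cases_le)
    show "continuous_on {w \<in> S. Re w \<le> 0} (\<lambda>w. F (exp w))"
      by (intro continuous_on_compose2[OF F(1)] continuous_intros) auto
    show "continuous_on {w \<in> S. 0 \<le> Re w} (\<lambda>w. E (exp w))"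
      by (intro continuous_on_compose2[OF E(1)] continuous_intros) (auto simp: S_def)
  qed (auto intro!: continuous_intros FE)
  have hol: "\<Phi> holomorphic_on S"
    by (rule holomorphic_on_paste_across_line[OF S(1), of 1 _ 0])
       (use hol1 hol2 cont in \<open>auto simp: inner_complex_def\<close>)
  have dcomp: "deriv \<Phi> w = deriv G (exp w) * exp w"
    if "w \<in> T" "open T" "\<And>w. w \<in> T \<Longrightarrow> \<Phi> w = G (exp w)" "G field_differentiable at (exp w)" for G w T
  proof -
    have "deriv \<Phi> w = deriv (\<lambda>w. G (exp w)) w"
    proof (rule deriv_cong_ev)
      show "\<forall>\<^sub>F w in nhds w. \<Phi> w = G (exp w)"
        using eventually_nhds_in_open[OF that(2,1)] by eventually_elim (rule that(3))
    qed simp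
    also have "\<dots> = deriv G (exp w) * exp w"
      using deriv_chain[of exp w G] that(4) by (simp add: o_def field_differentiable_within_exp DERIV_imp_deriv[OF DERIV_exp])
    finally show ?thesis .
  qed
  \<comment> \<open>All of \<open>Z\<close> lies outside the disc, so the entire left half-plane
    belongs to \<open>S\<close> and can start the continuation.\<close>
  have "exp w \<notin> Z" if "Re w < 0" for w
    using Z(2)[of "exp w"] that by auto
  then have sub: "{w. Re w < 0} \<subseteq> S" by (auto simp: S_def)
  have "deriv \<Phi> w = H (exp w) * exp w" if "w \<in> S" for w
  proof (rule analytic_continuation_open[OF oL(1) S(1) _ S(2) sub _ _ _ that])
    show "{w. Re w < 0} \<noteq> {}" by (auto intro!: exI[of _ "-1"])
    show "deriv \<Phi> holomorphic_on S" by (rule holomorphic_deriv[OF hol S(1)])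
    show "(\<lambda>w. H (exp w) * exp w) holomorphic_on S"
      by (rule holomorphic_on_mult[OF holomorphic_on_compose_gen[OF holomorphic_on_exp H(1) expS, unfolded o_def]
            holomorphic_on_exp])
    fix w assume w: "w \<in> {w. Re w < 0}"
    have "F field_differentiable at (exp w)"
      using F(2) w by (intro holomorphic_on_imp_differentiable_at[of _ "ball 0 1"]) auto
    then have "deriv \<Phi> w = deriv F (exp w) * exp w"
      by (intro dcomp[OF w oL(1)]) (auto simp: \<Phi>_def)
    then show "deriv \<Phi> w = H (exp w) * exp w" using H(2)[of "exp w"] w by simp
  qed
  note D\<Phi> = this
  have zn: "z \<noteq> 0" using z by auto
  have Lz: "exp (Ln z) = z" "Ln z \<in> S" "Ln z \<in> {w. 0 < Re w}"
    unfolding S_def using z zn by simp_all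
  then have 1: "deriv \<Phi> (Ln z) = H z * z" using D\<Phi>[OF Lz(2)] by simp
  have "open ({z. norm z > 1} - Z)"
    using Z by (intro open_Diff open_Collect_less continuous_intros) (auto intro: finite_imp_closed)
  then have "E field_differentiable at z"
    using z by (intro holomorphic_on_imp_differentiable_at[OF E(2)]) auto
  then have "deriv \<Phi> (Ln z) = deriv E (exp (Ln z)) * exp (Ln z)"
    by (intro dcomp[OF Lz(3) oL(2)]) (simp_all add: \<Phi>_def Lz(1))
  then show ?thesis using 1 Lz zn by simp
qed

text \<open>The factor \<open>z\<close> contributes the 1. The logarithmic derivative of
  \<open>reflect g\<close> is minus the displayed sum divided by \<open>z\<close>, and contributes
  the sum. This is the origin of the bracket in the velocity of the zeros.\<close>

lemma divide_reflect_has_field_derivative: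
  fixes a \<rho> :: "'i \<Rightarrow> complex"
  assumes z: "norm z > 1" and g: "g (1 / cnj z) \<noteq> 0"
    and der: "(g has_field_derivative g (1 / cnj z) * (\<Sum>y\<in>X. \<rho> y / (1 / cnj z - a y))) (at (1 / cnj z))"
  shows "((\<lambda>z. c * z / reflect g z) has_field_derivative
           c / reflect g z * (1 + (\<Sum>y\<in>X. cnj (\<rho> y) / (1 - cnj (a y) * z)))) (at z)"
proof -
  let ?S = "\<Sum>y\<in>X. cnj (\<rho> y) / (1 - cnj (a y) * z)"
  have zn: "z \<noteq> 0" using z by auto
  have G: "reflect g z \<noteq> 0" using g by (simp add: reflect_def)
  have "cnj (\<Sum>y\<in>X. \<rho> y / (1 / cnj z - a y)) = z * ?S"
    unfolding cnj_sum sum_distrib_left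
  proof (intro sum.cong refl)
    fix y
    have "1 / z - cnj (a y) = (1 - cnj (a y) * z) / z" using zn by (simp add: field_simps)
    then show "cnj (\<rho> y / (1 / cnj z - a y)) = z * (cnj (\<rho> y) / (1 - cnj (a y) * z))" by simp
  qed
  then have "cnj (g (1 / cnj z) * (\<Sum>y\<in>X. \<rho> y / (1 / cnj z - a y))) = reflect g z * (z * ?S)"
    by (simp add: reflect_def)
  from reflect_has_field_derivative[OF der zn, unfolded this]
  have "(reflect g has_field_derivative - (reflect g z * (z * ?S)) / z\<^sup>2) (at z)" .
  then have "((\<lambda>z. c * z / reflect g z) has_field_derivative
      (c * reflect g z - c * z * (- (reflect g z * (z * ?S)) / z\<^sup>2)) / (reflect g z * reflect g z)) (at z)"
    using G by (auto intro!: derivative_eq_intros)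
  moreover have "(c * reflect g z - c * z * (- (reflect g z * (z * ?S)) / z\<^sup>2)) / (reflect g z * reflect g z)
      = c / reflect g z * (1 + ?S)"
    using zn G by (simp add: divide_simps power2_eq_square) (simp add: algebra_simps)
  ultimately show ?thesis by simp
qed

text \<open>Zeros and poles of \<open>g\<close> are treated at once: they differ only in the residue
  \<open>\<rho> x\<close> and the limit \<open>\<kappa>\<close>. The numbers \<open>v\<close> enter
  only as coefficients in \<open>Fder\<close>.\<close>

lemma pole_velocity:
  fixes a \<rho> v :: "'i \<Rightarrow> complex" and F g :: "complex \<Rightarrow> complex" and q :: real
  assumes X: "finite X" "inj_on a X" and out: "\<And>x. x \<in> X \<Longrightarrow> norm (a x) > 1"
    and gder: "\<And>z. z \<notin> a ` X \<Longrightarrow> (g has_field_derivative g z * (\<Sum>y\<in>X. \<rho> y / (z - a y))) (at z)"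
    and gnz: "\<And>z. z \<notin> a ` X \<Longrightarrow> g z \<noteq> 0"
    and Fcont: "continuous_on (cball 0 1) F" and Fhol: "F holomorphic_on ball 0 1" and F0: "F 0 = 0"
    and Fq: "\<And>z. norm z = 1 \<Longrightarrow> Re (F z * cnj (z * g z)) = q"
    and im: "Im (deriv F 0 / g 0) = 0"
    and Fder: "\<And>z. z \<in> ball 0 1 \<Longrightarrow>
        deriv (\<lambda>z. deriv F z / g z) z = (\<Sum>y\<in>X. \<rho> y * v y / (z - a y)\<^sup>2)"
    and x: "x \<in> X" and \<kappa>: "((\<lambda>z. (z - a x) / g z) \<longlongrightarrow> \<kappa>) (at (a x))"
  shows "\<rho> x * v x = \<rho> x * (a x * reflect (schwarz_integral (\<lambda>z. q / (norm (g z))\<^sup>2)) (a x))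
      - \<kappa> * (2 * of_real q / reflect g (a x) * (1 + (\<Sum>y\<in>X. cnj (\<rho> y) / (1 - cnj (a y) * a x))))"
proof -
  let ?Z = "a ` X"
  have Zfin: "finite ?Z" using X by simp
  have Zout: "norm z > 1" if "z \<in> ?Z" for z using that out by auto
  have cbZ: "z \<notin> ?Z" if "norm z \<le> 1" for z using Zout[of z] that by auto
  have ghol: "g holomorphic_on - ?Z"
    using gder by (intro holomorphic_onI) (auto simp: field_differentiable_def intro: has_field_derivative_at_within)
  have gcont: "continuous_on (- ?Z) g" using holomorphic_on_imp_continuous_on[OF ghol] .
  have gcb: "continuous_on (cball 0 1) g" "g holomorphic_on ball 0 1"
    by (rule continuous_on_subset[OF gcont] holomorphic_on_subset[OF ghol]; use cbZ in force)+
  obtain p where pcont: "continuous_on (cball 0 1) p" and phol: "p holomorphic_on ball 0 1"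
    and Fp: "\<And>z. norm z \<le> 1 \<Longrightarrow> F z = z * g z * p z"
    and Rep: "\<And>z. norm z = 1 \<Longrightarrow> Re (p z) = q / (norm (g z))\<^sup>2"
    and pS: "\<And>z. norm z < 1 \<Longrightarrow> p z = schwarz_integral (\<lambda>z. q / (norm (g z))\<^sup>2) z"
    by (rule PG_potential_factorization[OF Fcont Fhol F0 gcb gnz Fq im]) (use cbZ in auto)
  \<comment> \<open>An antiderivative of the right-hand side of \<open>Fder\<close>, so that
    \<open>deriv F z / g z\<close> is \<open>T z\<close> plus a constant in the disc.\<close>
  define T where "T z = - (\<Sum>y\<in>X. \<rho> y * v y / (z - a y))" for z
  have Tder: "(T has_field_derivative (\<Sum>y\<in>X. \<rho> y * v y / (z - a y)\<^sup>2)) (at z)" if "z \<notin> ?Z" for z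
  proof -
    have "((\<lambda>z. \<Sum>y\<in>X. \<rho> y * v y / (z - a y)) has_field_derivative
        (\<Sum>y\<in>X. - (\<rho> y * v y / (z - a y)\<^sup>2))) (at z)"
      using that by (intro DERIV_sum) (auto intro!: derivative_eq_intros simp: power2_eq_square)
    from DERIV_minus[OF this] show ?thesis unfolding T_def by (simp add: sum_negf)
  qed
  have Thol: "T holomorphic_on - ?Z"
    using Tder by (intro holomorphic_onI) (auto simp: field_differentiable_def intro: has_field_derivative_at_within)
  have dFhol: "(\<lambda>z. deriv F z / g z) holomorphic_on ball 0 1"
    using cbZ gnz by (intro holomorphic_intros holomorphic_deriv Fhol gcb(2)) auto
  have "((\<lambda>z. deriv F z / g z - T z) has_field_derivative 0) (at z within ball 0 1)" if z: "z \<in> ball 0 1" for z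
  proof -
    have "((\<lambda>z. deriv F z / g z) has_field_derivative (\<Sum>y\<in>X. \<rho> y * v y / (z - a y)\<^sup>2)) (at z)"
      using holomorphic_derivI[OF dFhol open_ball z] Fder[OF z] by simp
    from DERIV_diff[OF this Tder] z cbZ
    show ?thesis by (simp add: has_field_derivative_at_within)
  qed
  then obtain C where C: "\<And>z. z \<in> ball 0 1 \<Longrightarrow> deriv F z / g z - T z = C"
    using has_field_derivative_zero_constant[OF convex_ball, of 0 1 "\<lambda>z. deriv F z / g z - T z"] by blast
  define K where "K z = 2 * of_real q * z / reflect g z" for z :: complex
  define K' where "K' z = 2 * of_real q / reflect g z * (1 + (\<Sum>y\<in>X. cnj (\<rho> y) / (1 - cnj (a y) * z)))" for z :: complex
  define W where "W z = z * reflect p z" for z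
  \<comment> \<open>The continuation of \<open>F\<close> to the exterior, from \<open>p + p* = 2 q / (g g*)\<close> on the circle.\<close>
  define E where "E z = K z - g z * W z" for z
  have inv: "1 / cnj z \<notin> ?Z" if "norm z \<ge> 1" for z
    using that by (intro cbZ) (auto simp: norm_divide divide_le_eq)
  have Gnz: "reflect g z \<noteq> 0" if "norm z \<ge> 1" for z
    using gnz[OF inv[OF that]] by (simp add: reflect_def)
  have Kder: "(K has_field_derivative K' z) (at z)" if "norm z > 1" for z
    unfolding K_def K'_def using that inv[of z]
    by (intro divide_reflect_has_field_derivative gder gnz) auto
  have Whol: "W holomorphic_on {z. norm z > 1}"
    unfolding W_def by (intro holomorphic_intros reflect_holomorphic_on phol)
  have o1: "open {z::complex. norm z > 1}" by (intro open_Collect_less continuous_intros)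
  have Ehol: "E holomorphic_on {z. norm z > 1} - ?Z"
    unfolding E_def K_def
    using Gnz by (intro holomorphic_intros holomorphic_on_subset[OF Whol] holomorphic_on_subset[OF ghol]
        holomorphic_on_subset[OF reflect_holomorphic_on[OF gcb(2)]]) auto
  have Econt: "continuous_on ({z. norm z \<ge> 1} - ?Z) E"
    unfolding E_def K_def W_def
    using Gnz by (intro continuous_intros continuous_on_subset[OF gcont]
        continuous_on_subset[OF reflect_continuous_on[OF gcb(1)]]
        continuous_on_subset[OF reflect_continuous_on[OF pcont]]) auto
  have FE: "F z = E z" if z: "norm z = 1" for z
  proof -
    have u: "1 / cnj z = z" by (rule norm_eq_1_imp_inverse_cnj[OF z])
    have g0: "g z \<noteq> 0" using gnz cbZ z by simp
    have "p z + cnj (p z) = of_real (2 * Re (p z))" by (simp add: complex_add_cnj)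
    also have "\<dots> = 2 * of_real q / (g z * cnj (g z))"
      unfolding Rep[OF z] complex_norm_square[symmetric] by simp
    finally have "p z = 2 * of_real q / (g z * cnj (g z)) - cnj (p z)" by (simp add: algebra_simps)
    then have "z * g z * p z = z * g z * (2 * of_real q / (g z * cnj (g z)) - cnj (p z))" by simp
    also have "\<dots> = E z"
      unfolding E_def K_def W_def reflect_def u using g0 by (simp add: divide_simps) (simp add: algebra_simps)
    finally show ?thesis using Fp[of z] z by simp
  qed
  have dE: "deriv E z = g z * (T z + C)" if "norm z > 1" "z \<notin> ?Z" for z
  proof (rule holomorphic_extension_across_circle[OF Zfin Zout Fcont Fhol Econt Ehol FE _ _ that])
    show "(\<lambda>z. g z * (T z + C)) holomorphic_on - ?Z"
      by (intro holomorphic_intros ghol Thol)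
    show "deriv F z = g z * (T z + C)" if "z \<in> ball 0 1" for z
      using C[OF that] gnz[of z] cbZ[of z] that by (auto simp: field_simps)
  qed
  have eq: "K' z - (deriv W z * g z + W z * (g z * (\<Sum>y\<in>X. \<rho> y / (z - a y)))) = g z * (T z + C)"
    if z: "norm z > 1" "z \<notin> ?Z" for z
  proof -
    have "(W has_field_derivative deriv W z) (at z)"
      using z by (intro holomorphic_derivI[OF Whol o1]) auto
    from DERIV_diff[OF Kder[OF z(1)] DERIV_mult[OF gder[OF z(2)] this]]
    have "(E has_field_derivative K' z - (g z * (\<Sum>y\<in>X. \<rho> y / (z - a y)) * W z + deriv W z * g z)) (at z)"
      unfolding E_def .
    then show ?thesis using dE[OF z] by (simp add: DERIV_imp_deriv algebra_simps)
  qed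
  \<comment> \<open>The identity \<open>eq\<close>, multiplied by \<open>(z - a x) / g z\<close> and
    brought to one side. Up to sign, its terms tend at \<open>a x\<close> to
    \<open>\<kappa> * K' (a x)\<close>, 0, \<open>W (a x) * \<rho> x\<close>,
    \<open>\<rho> x * v x\<close> and 0.\<close>
  let ?L = "\<lambda>z. (z - a x) / g z * K' z - (z - a x) * deriv W z - W z * ((z - a x) * (\<Sum>y\<in>X. \<rho> y / (z - a y)))
      + (z - a x) * (\<Sum>y\<in>X. \<rho> y * v y / (z - a y)) - (z - a x) * C"
  have ax: "norm (a x) > 1" using out x by simp
  have pf: "((\<lambda>z. (z - a x) * (\<Sum>y\<in>X. c y / (z - a y))) \<longlongrightarrow> c x) (at (a x))" for c :: "'i \<Rightarrow> complex"
  proof -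
    have "((\<lambda>z. c x + (z - a x) * (\<Sum>y\<in>X - {x}. c y / (z - a y))) \<longlongrightarrow>
        c x + (a x - a x) * (\<Sum>y\<in>X - {x}. c y / (a x - a y))) (at (a x))"
      using X x by (intro tendsto_intros) (auto simp: inj_on_def)
    moreover have "\<forall>\<^sub>F z in at (a x). c x + (z - a x) * (\<Sum>y\<in>X - {x}. c y / (z - a y)) =
        (z - a x) * (\<Sum>y\<in>X. c y / (z - a y))"
      using X x by (simp add: eventually_at_filter sum.remove[of X x] distrib_left)
    ultimately show ?thesis by (simp add: Lim_transform_eventually)
  qed
  have "isCont (reflect g) (a x)" "isCont W (a x)" "isCont (deriv W) (a x)"
    using ax holomorphic_on_imp_continuous_on[OF reflect_holomorphic_on[OF gcb(2)]]
      holomorphic_on_imp_continuous_on[OF Whol] holomorphic_on_imp_continuous_on[OF holomorphic_deriv[OF Whol o1]]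
      continuous_on_eq_continuous_at[OF o1] by auto
  note cont = this[unfolded isCont_def]
  have nz: "1 - cnj (a y) * a x \<noteq> 0" if "y \<in> X" for y
  proof -
    have "norm (cnj (a y) * a x) > 1"
      using out[OF that] ax by (simp add: norm_mult less_1_mult)
    then have "cnj (a y) * a x \<noteq> 1" by force
    then show ?thesis by simp
  qed
  have K'lim: "(K' \<longlongrightarrow> K' (a x)) (at (a x))"
    unfolding K'_def using Gnz[of "a x"] ax nz
    by (intro tendsto_intros cont) auto
  have "(?L \<longlongrightarrow> \<kappa> * K' (a x) - (a x - a x) * deriv W (a x) - W (a x) * \<rho> x + \<rho> x * v x - (a x - a x) * C) (at (a x))"
    by (intro tendsto_intros \<kappa> K'lim cont pf)
  moreover have "\<forall>\<^sub>F z in at (a x). ?L z = 0"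
  proof -
    have "\<forall>\<^sub>F z in at (a x). z \<in> {z. norm z > 1} - (?Z - {a x}) \<and> z \<noteq> a x"
      using eventually_nhds_in_open[of "{z. norm z > 1} - (?Z - {a x})" "a x"] o1 Zfin ax
      by (auto simp: eventually_at_filter open_Diff finite_imp_closed elim: eventually_mono)
    then show ?thesis
    proof eventually_elim
      case (elim z)
      then have z: "norm z > 1" "z \<notin> ?Z" by auto
      have "?L z = (z - a x) / g z *
          (K' z - (deriv W z * g z + W z * (g z * (\<Sum>y\<in>X. \<rho> y / (z - a y)))) - g z * (T z + C))"
        unfolding T_def using gnz[OF z(2)] by (simp add: divide_simps) (simp add: algebra_simps)
      then show ?case unfolding eq[OF z] by simp
    qed
  qed
  ultimately have "((\<lambda>_. 0) \<longlongrightarrow> \<kappa> * K' (a x) - (a x - a x) * deriv W (a x) - W (a x) * \<rho> x + \<rho> x * v x - (a x - a x) * C) (at (a x))"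
    by (rule Lim_transform_eventually)
  from tendsto_unique[OF at_neq_bot tendsto_const this]
  have "\<kappa> * K' (a x) - W (a x) * \<rho> x + \<rho> x * v x = 0" by simp
  then have "\<rho> x * v x = \<rho> x * W (a x) - \<kappa> * K' (a x)" by (simp add: algebra_simps)
  moreover have "W (a x) = a x * reflect (schwarz_integral (\<lambda>z. q / (norm (g z))\<^sup>2)) (a x)"
    unfolding W_def reflect_def using ax by (subst pS) (auto simp: norm_divide divide_less_eq)
  ultimately show ?thesis by (simp add: K'_def)
qed

section \<open>Rational solutions\<close>

lemma has_vector_derivative_divide_complex:
  fixes u w :: "real \<Rightarrow> complex"
  assumes u: "(u has_vector_derivative u') (at t within I)" and w: "(w has_vector_derivative w') (at t within I)"
    and nz: "w t \<noteq> 0"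
  shows "((\<lambda>s. u s / w s) has_vector_derivative (u' * w t - u t * w') / (w t)\<^sup>2) (at t within I)"
proof -
  have "(inverse has_field_derivative - inverse (w t ^ 2)) (at (w t) within w ` I)"
    using DERIV_inverse[OF nz] by (auto simp: numeral_2_eq_2 intro: has_field_derivative_at_within)
  from field_vector_diff_chain_within[OF w this]
  have "((\<lambda>s. inverse (w s)) has_vector_derivative w' * - inverse (w t ^ 2)) (at t within I)"
    by (simp add: o_def)
  from has_vector_derivative_mult[OF u this]
  have "((\<lambda>s. u s / w s) has_vector_derivative
      u t * (w' * - inverse (w t ^ 2)) + u' * inverse (w t)) (at t within I)"
    by (simp add: divide_inverse)
  moreover have "u t * (w' * - inverse (w t ^ 2)) + u' * inverse (w t) = (u' * w t - u t * w') / (w t)\<^sup>2"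
    using nz by (simp add: divide_simps power2_eq_square)
  ultimately show ?thesis by simp
qed

text \<open>To be used with \<open>u\<close> as the poles at a reference time, which define the
  groups and their sizes, and \<open>v\<close> as the poles at a nearby time.\<close>

lemma sum_group_representatives:
  fixes h :: "'b \<Rightarrow> complex"
  assumes A: "finite A" and J: "J \<subseteq> A" "inj_on u J" "u ` A = u ` J"
    and v: "\<And>i j. i \<in> A \<Longrightarrow> j \<in> A \<Longrightarrow> u i = u j \<Longrightarrow> v i = v j"
  shows "(\<Sum>j\<in>A. h (v j)) = (\<Sum>i\<in>J. of_nat (card {j \<in> A. u j = u i}) * h (v i))"
proof -
  have "(\<Sum>j\<in>A. h (v j)) = (\<Sum>y\<in>u ` J. \<Sum>j\<in>{j \<in> A. u j = y}. h (v j))"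
    using sum.image_gen[OF A, of "\<lambda>j. h (v j)" u] J(3) by simp
  also have "\<dots> = (\<Sum>i\<in>J. \<Sum>j\<in>{j \<in> A. u j = u i}. h (v j))"
    by (simp add: sum.reindex[OF J(2)])
  also have "\<dots> = (\<Sum>i\<in>J. \<Sum>j\<in>{j \<in> A. u j = u i}. h (v i))"
    using J(1) v by (intro sum.cong refl arg_cong[of _ _ h]) auto
  finally show ?thesis by simp
qed

text \<open>\<open>v\<close> factors through \<open>u\<close> by a map from the image of
  \<open>u\<close> onto the image of \<open>v\<close>. Once the cardinalities agree, this map is
  injective, which reverses the implication.\<close>

lemma card_image_le_if_factors:
  assumes "finite A" "\<And>i j. i \<in> A \<Longrightarrow> j \<in> A \<Longrightarrow> u i = u j \<Longrightarrow> v i = v j"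
  shows "card (v ` A) \<le> card (u ` A)"
    and "card (u ` A) \<le> card (v ` A) \<Longrightarrow> i \<in> A \<Longrightarrow> j \<in> A \<Longrightarrow> v i = v j \<Longrightarrow> u i = u j"
proof -
  define h where "h = v \<circ> inv_into A u"
  have h: "h (u i) = v i" if "i \<in> A" for i
    unfolding h_def o_def
    by (rule assms(2)) (use that in \<open>auto intro: inv_into_into f_inv_into_f\<close>)
  then have img: "v ` A = h ` (u ` A)" by (auto simp: image_image)
  show le: "card (v ` A) \<le> card (u ` A)" unfolding img using assms(1) by (intro card_image_le) simp
  assume "card (u ` A) \<le> card (v ` A)" "i \<in> A" "j \<in> A" "v i = v j"
  with le have "card (h ` (u ` A)) = card (u ` A)" unfolding img by simp
  then have "inj_on h (u ` A)" using assms(1) by (intro eq_card_imp_inj_on) auto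
  then show "u i = u j" by (rule inj_onD) (use h \<open>i \<in> A\<close> \<open>j \<in> A\<close> \<open>v i = v j\<close> in auto)
qed

lemma has_log_derivativeI:
  assumes t: "t \<in> I" and nz: "\<And>s. s \<in> I \<Longrightarrow> w s \<noteq> 0"
    and der: "(w has_vector_derivative w t * D) (at t within I)"
  shows "has_log_derivative w D t I"
proof -
  \<comment> \<open>Division by \<open>w t\<close> moves the values near \<open>t\<close> close to
    1, away from the branch cut of \<open>Ln\<close>.\<close>
  define L where "L s = Ln (w s / w t) + Ln (w t)" for s
  have expL: "exp (L s) = w s" if "s \<in> I" for s
    using nz[OF that] nz[OF t] by (simp add: L_def exp_add)
  have "((\<lambda>s. w s / w t) has_vector_derivative w t * D / w t) (at t within I)"
    using der by (rule has_vector_derivative_divide)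
  then have 1: "((\<lambda>s. w s / w t) has_vector_derivative D) (at t within I)" using nz[OF t] by simp
  have "(Ln has_field_derivative inverse (w t / w t)) (at (w t / w t) within (\<lambda>s. w s / w t) ` I)"
    by (rule has_field_derivative_at_within, rule has_field_derivative_Ln) (use nz[OF t] in auto)
  from field_vector_diff_chain_within[OF 1 this]
  have "((\<lambda>s. Ln (w s / w t)) has_vector_derivative D) (at t within I)"
    using nz[OF t] by (simp add: o_def)
  then have "(L has_vector_derivative D) (at t within I)"
    unfolding L_def[abs_def] by (rule has_vector_derivative_add_const[THEN iffD2])
  then show ?thesis
    unfolding has_log_derivative_def using expL t by (auto simp: eventually_at_filter intro!: exI[of _ L])
qed

locale rational_PG_solution =
  fixes I :: "real set" and q :: "real \<Rightarrow> real" and f g :: "complex \<Rightarrow> real \<Rightarrow> complex"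
    and m n :: nat and b :: "real \<Rightarrow> complex" and \<omega> \<zeta> :: "nat \<Rightarrow> real \<Rightarrow> complex"
  assumes sol: "locally_univalent_PG_solution I q f"
    and g_form: "\<And>z t. t \<in> I \<Longrightarrow>
        g z t = b t * (\<Prod>k=1..m. z - \<omega> k t) / (\<Prod>j=1..n. z - \<zeta> j t)"
    and g_deriv: "\<And>z t. t \<in> I \<Longrightarrow> z \<in> cball 0 1 \<Longrightarrow> deriv (\<lambda>x. f x t) z = g z t"
    and b_nz: "\<And>t. t \<in> I \<Longrightarrow> b t \<noteq> 0"
    and \<omega>_outside: "\<And>k t. k \<in> {1..m} \<Longrightarrow> t \<in> I \<Longrightarrow> cmod (\<omega> k t) > 1"
    and \<zeta>_outside: "\<And>j t. j \<in> {1..n} \<Longrightarrow> t \<in> I \<Longrightarrow> cmod (\<zeta> j t) > 1"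
    and \<omega>_cont: "\<And>k. k \<in> {1..m} \<Longrightarrow> continuous_on I (\<omega> k)"
    and \<zeta>_cont: "\<And>j. j \<in> {1..n} \<Longrightarrow> continuous_on I (\<zeta> j)"
    and no_cancel: "\<And>k j t. k \<in> {1..m} \<Longrightarrow> j \<in> {1..n} \<Longrightarrow> t \<in> I \<Longrightarrow> \<omega> k t \<noteq> \<zeta> j t"
    and simple_zeros: "\<And>t. t \<in> I \<Longrightarrow> inj_on (\<lambda>k. \<omega> k t) {1..m}"
begin

text \<open>On the circle \<open>g\<close> is the derivative of \<open>f\<close>, so this is
  \<open>PG_Poisson\<close> as a Schwarz integral.\<close>

definition Poisson :: "real \<Rightarrow> complex \<Rightarrow> complex" where
  "Poisson t = schwarz_integral (\<lambda>z. q t / (norm (g z t))\<^sup>2)"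

text \<open>The value of \<open>g' / g\<close> off the zeros and poles. The factor \<open>b\<close>
  has dropped out, so only the roots depend on time.\<close>

definition log_deriv :: "complex \<Rightarrow> real \<Rightarrow> complex" where
  "log_deriv z t = (\<Sum>k=1..m. 1 / (z - \<omega> k t)) - (\<Sum>j=1..n. 1 / (z - \<zeta> j t))"

lemma interval: "is_interval I" and q_cont: "continuous_on I q"
  using sol by (simp_all add: locally_univalent_PG_solution_def)

text \<open>\<open>I\<close> is a nondegenerate interval, so limits within \<open>I\<close> are
  unique even at its end points.\<close>

lemma islimpt_I: "t \<in> I \<Longrightarrow> t islimpt I"
proof (rule connected_imp_perfect)
  show "connected I" using interval by (simp add: is_interval_connected)
  have "interior I \<noteq> {}" using sol by (simp add: locally_univalent_PG_solution_def)
  then show "I \<noteq> {x}" for x by auto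
qed

lemma nontrivial_at_within: "t \<in> I \<Longrightarrow> at t within I \<noteq> bot"
  using islimpt_I by (simp add: trivial_limit_within)

lemma \<omega>_tendsto: "k \<in> {1..m} \<Longrightarrow> t \<in> I \<Longrightarrow> (\<omega> k \<longlongrightarrow> \<omega> k t) (at t within I)"
  using \<omega>_cont by (simp add: continuous_on_def)

lemma \<zeta>_tendsto: "j \<in> {1..n} \<Longrightarrow> t \<in> I \<Longrightarrow> (\<zeta> j \<longlongrightarrow> \<zeta> j t) (at t within I)"
  using \<zeta>_cont by (simp add: continuous_on_def)

lemma g_nonzero:
  assumes "t \<in> I" "\<And>k. k \<in> {1..m} \<Longrightarrow> z \<noteq> \<omega> k t" "\<And>j. j \<in> {1..n} \<Longrightarrow> z \<noteq> \<zeta> j t"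
  shows "g z t \<noteq> 0"
  using assms b_nz by (simp add: g_form)

lemma disc_avoids:
  assumes "t \<in> I" "norm z \<le> 1"
  shows "k \<in> {1..m} \<Longrightarrow> z \<noteq> \<omega> k t" "j \<in> {1..n} \<Longrightarrow> z \<noteq> \<zeta> j t"
  using assms \<omega>_outside[of k t] \<zeta>_outside[of j t] by auto

lemma g_nonzero_on_disc: "t \<in> I \<Longrightarrow> norm z \<le> 1 \<Longrightarrow> g z t \<noteq> 0"
  by (rule g_nonzero) (use disc_avoids in blast)+

lemma g_has_field_derivative:
  assumes t: "t \<in> I" and z: "\<And>k. k \<in> {1..m} \<Longrightarrow> z \<noteq> \<omega> k t" "\<And>j. j \<in> {1..n} \<Longrightarrow> z \<noteq> \<zeta> j t"
  shows "((\<lambda>z. g z t) has_field_derivative g z t * log_deriv z t) (at z)"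
proof -
  have 1: "((\<lambda>u. \<Prod>k=1..m. u - \<omega> k t) has_field_derivative
      (\<Prod>k=1..m. z - \<omega> k t) * (\<Sum>k=1..m. 1 / (z - \<omega> k t))) (at z)"
    using z by (intro has_field_derivative_prod') (auto intro!: derivative_eq_intros)
  have 2: "((\<lambda>u. \<Prod>j=1..n. u - \<zeta> j t) has_field_derivative
      (\<Prod>j=1..n. z - \<zeta> j t) * (\<Sum>j=1..n. 1 / (z - \<zeta> j t))) (at z)"
    using z by (intro has_field_derivative_prod') (auto intro!: derivative_eq_intros)
  have nz: "(\<Prod>j=1..n. z - \<zeta> j t) \<noteq> 0" using z by simp
  have "((\<lambda>u. b t * (\<Prod>k=1..m. u - \<omega> k t) / (\<Prod>j=1..n. u - \<zeta> j t)) has_field_derivative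
     (b t * ((\<Prod>k=1..m. z - \<omega> k t) * (\<Sum>k=1..m. 1 / (z - \<omega> k t))) * (\<Prod>j=1..n. z - \<zeta> j t)
       - b t * (\<Prod>k=1..m. z - \<omega> k t) * ((\<Prod>j=1..n. z - \<zeta> j t) * (\<Sum>j=1..n. 1 / (z - \<zeta> j t))))
     / ((\<Prod>j=1..n. z - \<zeta> j t) * (\<Prod>j=1..n. z - \<zeta> j t))) (at z)"
    by (rule DERIV_divide[OF DERIV_cmult[OF 1] 2 nz])
  moreover have "(b t * (N * L) * D - b t * N * (D * M)) / (D * D) = b t * N / D * (L - M)"
    if "D \<noteq> 0" for N L D M
    using that by (simp add: divide_simps) (simp add: algebra_simps)
  ultimately show ?thesis using nz by (simp add: log_deriv_def g_form[OF t])
qed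

lemma time_derivative_real:
  assumes "t \<in> I" "(h has_vector_derivative D) (at t within I)" "\<And>s. s \<in> I \<Longrightarrow> Im (h s) = 0"
  shows "Im (D::complex) = 0"
proof -
  have "((\<lambda>s. Im ((h s - h t) / of_real (s - t))) \<longlongrightarrow> Im D) (at t within I)"
    using assms(2) unfolding has_vector_derivative_iff_difference_quotient by (rule tendsto_Im)
  moreover have "\<forall>\<^sub>F s in at t within I. Im ((h s - h t) / of_real (s - t)) = 0"
    using assms by (simp add: eventually_at_filter Im_divide_of_real del: of_real_diff)
  ultimately have "((\<lambda>s. 0) \<longlongrightarrow> Im D) (at t within I)" by (rule Lim_transform_eventually)
  then show ?thesis using tendsto_unique[OF nontrivial_at_within[OF assms(1)] tendsto_const] by metis
qed

text \<open>\<open>F\<close> is the time derivative of \<open>f\<close> at \<open>t\<close>. As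
  \<open>log_deriv\<close> is the quotient of the second and first derivatives of \<open>f\<close>,
  commuting the derivatives and the quotient rule yield exactly the \<open>z\<close>-derivative of
  \<open>deriv F z / g z t\<close>. The condition on the imaginary part comes from
  \<open>g 0 s\<close> being real at all times.\<close>

lemma time_derivatives:
  assumes t: "t \<in> I"
  obtains F where "continuous_on (cball 0 1) F" "F holomorphic_on ball 0 1" "F 0 = 0"
    "\<And>z. norm z = 1 \<Longrightarrow> Re (F z * cnj (z * g z t)) = q t"
    "Im (deriv F 0 / g 0 t) = 0"
    "\<And>z. z \<in> ball 0 1 \<Longrightarrow> ((\<lambda>s. g z s) has_vector_derivative deriv F z) (at t within I)"
    "\<And>z. z \<in> ball 0 1 \<Longrightarrow> (log_deriv z has_vector_derivative deriv (\<lambda>z. deriv F z / g z t) z) (at t within I)"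
proof -
  obtain ft where ft: "\<And>s z. s \<in> I \<Longrightarrow> z \<in> cball 0 1 \<Longrightarrow> (f z has_vector_derivative ft z s) (at s within I)"
    and ftcont: "continuous_on (cball 0 1 \<times> I) (\<lambda>(z, s). ft z s)"
    and ftq: "\<And>s z. s \<in> I \<Longrightarrow> z \<in> sphere 0 1 \<Longrightarrow> Re (ft z s * cnj (z * deriv (\<lambda>z. f z s) z)) = q s"
    using sol unfolding locally_univalent_PG_solution_def by blast
  have an: "(\<lambda>z. f z s) analytic_on cball 0 1" and f0: "f 0 s = 0"
    and im0: "Im (deriv (\<lambda>z. f z s) 0) = 0" if "s \<in> I" for s
    using sol that unfolding locally_univalent_PG_solution_def by blast+
  define F where "F z = ft z t" for z
  have Fcont: "continuous_on (cball 0 1) F"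
  proof -
    have "continuous_on (cball 0 1) ((\<lambda>(z, s). ft z s) \<circ> (\<lambda>z. (z, t)))"
      using t by (intro continuous_on_compose continuous_intros continuous_on_subset[OF ftcont]) auto
    then show ?thesis by (simp add: F_def[abs_def] o_def)
  qed
  note hd = higher_deriv_time_derivative[OF interval t islimpt_I[OF t] ft ftcont an, folded F_def]
  have Fhol: "F holomorphic_on ball 0 1"
    using hd(1) by (simp add: F_def[abs_def])
  have gz: "((\<lambda>s. g z s) has_vector_derivative deriv F z) (at t within I)" if z: "z \<in> ball 0 1" for z
  proof (rule has_vector_derivative_transform[OF t])
    show "((\<lambda>s. deriv (\<lambda>z. f z s) z) has_vector_derivative deriv F z) (at t within I)"
      using hd(2)[OF _ _ _ z, of 1] by simp
    show "g z s = deriv (\<lambda>z. f z s) z" if "s \<in> I" for s using g_deriv[OF that, of z] z by simp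
  qed
  have dg: "((\<lambda>z. g z s) has_field_derivative g z s * log_deriv z s) (at z)" "g z s \<noteq> 0"
    if "s \<in> I" "norm z \<le> 1" for z s
    by (rule g_has_field_derivative g_nonzero; use that disc_avoids[OF that] in blast)+
  have ddf: "deriv (deriv (\<lambda>z. f z s)) z = g z s * log_deriv z s" if "s \<in> I" "z \<in> ball 0 1" for z s
  proof -
    have "deriv (deriv (\<lambda>z. f z s)) z = deriv (\<lambda>z. g z s) z"
    proof (rule deriv_cong_ev)
      show "\<forall>\<^sub>F z in nhds z. deriv (\<lambda>z. f z s) z = g z s"
        using eventually_nhds_in_open[OF open_ball that(2)] by eventually_elim (use g_deriv[OF that(1)] in auto)
    qed simp
    then show ?thesis using DERIV_imp_deriv[OF dg(1)[of s z]] that by simp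
  qed
  have ld: "(log_deriv z has_vector_derivative deriv (\<lambda>z. deriv F z / g z t) z) (at t within I)"
    if z: "z \<in> ball 0 1" for z
  proof (rule has_vector_derivative_transform[OF t])
    have z1: "norm z \<le> 1" using z by simp
    have "(deriv F has_field_derivative deriv (deriv F) z) (at z)"
      using holomorphic_derivI[OF holomorphic_deriv[OF Fhol open_ball] open_ball z] .
    from DERIV_divide[OF this dg[OF t z1]]
    have "deriv (\<lambda>z. deriv F z / g z t) z =
        (deriv (deriv F) z * g z t - deriv F z * (g z t * log_deriv z t)) / (g z t * g z t)"
      by (rule DERIV_imp_deriv)
    then have eq: "deriv (\<lambda>z. deriv F z / g z t) z =
        (deriv (deriv F) z * g z t - deriv (deriv (\<lambda>z. f z t)) z * deriv F z) / (g z t)\<^sup>2"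
      by (simp add: ddf[OF t z] power2_eq_square mult_ac)
    have "((\<lambda>s. deriv (deriv (\<lambda>z. f z s)) z) has_vector_derivative deriv (deriv F) z) (at t within I)"
      using hd(2)[OF _ _ _ z, of 2] by (simp add: numeral_2_eq_2)
    from has_vector_derivative_divide_complex[OF this gz[OF z] dg(2)[OF t z1]]
    show "((\<lambda>s. deriv (deriv (\<lambda>z. f z s)) z / g z s) has_vector_derivative
        deriv (\<lambda>z. deriv F z / g z t) z) (at t within I)"
      unfolding eq .
    show "log_deriv z s = deriv (deriv (\<lambda>z. f z s)) z / g z s" if "s \<in> I" for s
      using ddf[OF that z] dg(2)[OF that z1] by simp
  qed
  have F0: "F 0 = 0"
  proof -
    have "(f 0 has_vector_derivative F 0) (at t within I)" using ft[OF t, of 0] by (simp add: F_def)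
    moreover have "(f 0 has_vector_derivative 0) (at t within I)"
      by (rule has_vector_derivative_transform[OF t, of _ "\<lambda>_. 0"]) (auto simp: f0)
    ultimately show ?thesis unfolding has_vector_derivative_iff_difference_quotient
      by (rule tendsto_unique[OF nontrivial_at_within[OF t]])
  qed
  have img: "Im (g 0 s) = 0" if "s \<in> I" for s using im0[OF that] g_deriv[OF that, of 0] by simp
  have "Im (deriv F 0) = 0"
    using time_derivative_real[OF t gz img] by simp
  then have "Im (deriv F 0 / g 0 t) = 0" using img[OF t] by (simp add: Im_divide)
  moreover have "Re (F z * cnj (z * g z t)) = q t" if "norm z = 1" for z
    using ftq[OF t, of z] g_deriv[OF t, of z] that by (simp add: F_def)
  ultimately show thesis using that[OF Fcont Fhol F0 _ _ gz ld] by blast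
qed

text \<open>The cofactor \<open>h\<close> of \<open>z - \<omega> k t\<close> takes the value of the
  derivative of \<open>g\<close> at the zero, and this is nonzero because the zeros are distinct and
  \<open>b\<close> does not vanish.\<close>

lemma zero_quotient_tendsto:
  assumes t: "t \<in> I" and k: "k \<in> {1..m}"
  shows "((\<lambda>z. (z - \<omega> k t) / g z t) \<longlongrightarrow> 1 / deriv (\<lambda>z. g z t) (\<omega> k t)) (at (\<omega> k t))"
proof -
  define h where "h z = b t * (\<Prod>i\<in>{1..m} - {k}. z - \<omega> i t) / (\<Prod>j=1..n. z - \<zeta> j t)" for z
  have gh: "g z t = (z - \<omega> k t) * h z" for z
    unfolding g_form[OF t] h_def using k by (simp add: prod.remove[of _ k])
  have D: "(\<Prod>j=1..n. \<omega> k t - \<zeta> j t) \<noteq> 0" using no_cancel[OF k _ t] by simp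
  have hlim: "(h \<longlongrightarrow> h (\<omega> k t)) (at (\<omega> k t))"
    unfolding h_def by (intro tendsto_divide tendsto_mult tendsto_prod tendsto_diff tendsto_const tendsto_ident_at D)
  have "(\<Prod>i\<in>{1..m} - {k}. \<omega> k t - \<omega> i t) \<noteq> 0"
    using inj_onD[OF simple_zeros[OF t], of k] k by auto
  then have hnz: "h (\<omega> k t) \<noteq> 0" using D b_nz[OF t] by (simp add: h_def)
  have "((\<lambda>z. g z t) has_field_derivative h (\<omega> k t)) (at (\<omega> k t))"
    unfolding has_field_derivative_iff
    by (rule Lim_transform_eventually[OF hlim]) (simp add: eventually_at_filter gh)
  then have "deriv (\<lambda>z. g z t) (\<omega> k t) = h (\<omega> k t)" by (rule DERIV_imp_deriv)
  moreover have "((\<lambda>z. 1 / h z) \<longlongrightarrow> 1 / h (\<omega> k t)) (at (\<omega> k t))"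
    by (intro tendsto_divide tendsto_const hlim hnz)
  then have "((\<lambda>z. (z - \<omega> k t) / g z t) \<longlongrightarrow> 1 / h (\<omega> k t)) (at (\<omega> k t))"
    by (rule Lim_transform_eventually) (simp add: eventually_at_filter gh)
  ultimately show ?thesis by simp
qed

text \<open>\<open>1 / g\<close> has a finite limit at a pole of any multiplicity, so the factor
  \<open>z - \<zeta> j t\<close> forces the limit 0. In \<open>pole_velocity\<close> this removes
  the bracket term.\<close>

lemma pole_quotient_tendsto:
  assumes t: "t \<in> I" and j: "j \<in> {1..n}"
  shows "((\<lambda>z. (z - \<zeta> j t) / g z t) \<longlongrightarrow> 0) (at (\<zeta> j t))"
proof -
  have N: "b t * (\<Prod>k=1..m. \<zeta> j t - \<omega> k t) \<noteq> 0"
    using no_cancel[OF _ j t, symmetric] b_nz[OF t] by simp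
  have "((\<lambda>z. (z - \<zeta> j t) * (\<Prod>j=1..n. z - \<zeta> j t) / (b t * (\<Prod>k=1..m. z - \<omega> k t))) \<longlongrightarrow>
     (\<zeta> j t - \<zeta> j t) * (\<Prod>i=1..n. \<zeta> j t - \<zeta> i t) / (b t * (\<Prod>k=1..m. \<zeta> j t - \<omega> k t))) (at (\<zeta> j t))"
    by (intro tendsto_divide tendsto_mult tendsto_prod tendsto_diff tendsto_const tendsto_ident_at N)
  then show ?thesis by (simp add: g_form[OF t])
qed

text \<open>\<open>persist\<close> allows the sum over the poles to be regrouped near
  \<open>t\<close> into one term per distinct pole with constant residue, as
  \<open>simple_poles_differentiable\<close> demands. It remains a hypothesis because its proof at
  all times relies on this lemma at times with a maximal number of distinct poles.\<close>

lemma velocities: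
  assumes t: "t \<in> I"
    and persist: "\<forall>\<^sub>F s in at t within I. \<forall>i\<in>{1..n}. \<forall>j\<in>{1..n}. \<zeta> i t = \<zeta> j t \<longrightarrow> \<zeta> i s = \<zeta> j s"
  shows "k \<in> {1..m} \<Longrightarrow> (\<omega> k has_vector_derivative \<omega> k t * reflect (Poisson t) (\<omega> k t)
      - 1 / deriv (\<lambda>z. g z t) (\<omega> k t) * (2 * of_real (q t) / reflect (\<lambda>z. g z t) (\<omega> k t) *
          (1 + ((\<Sum>j=1..m. 1 / (1 - cnj (\<omega> j t) * \<omega> k t))
             - (\<Sum>j=1..n. 1 / (1 - cnj (\<zeta> j t) * \<omega> k t)))))) (at t within I)"
    and "j \<in> {1..n} \<Longrightarrow> (\<zeta> j has_vector_derivative \<zeta> j t * reflect (Poisson t) (\<zeta> j t)) (at t within I)"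
proof -
  obtain F where F: "continuous_on (cball 0 1) F" "F holomorphic_on ball 0 1" "F 0 = 0"
    "\<And>z. norm z = 1 \<Longrightarrow> Re (F z * cnj (z * g z t)) = q t"
    "Im (deriv F 0 / g 0 t) = 0"
    and "\<And>z. z \<in> ball 0 1 \<Longrightarrow> ((\<lambda>s. g z s) has_vector_derivative deriv F z) (at t within I)"
    and Fld: "\<And>z. z \<in> ball 0 1 \<Longrightarrow> (log_deriv z has_vector_derivative deriv (\<lambda>z. deriv F z / g z t) z) (at t within I)"
    by (rule time_derivatives[OF t]) (rule that; assumption)
  obtain J where J: "J \<subseteq> {1..n}" "(\<lambda>j. \<zeta> j t) ` {1..n} = (\<lambda>j. \<zeta> j t) ` J" "inj_on (\<lambda>j. \<zeta> j t) J"
    using subset_image_inj[of "(\<lambda>j. \<zeta> j t) ` {1..n}" "\<lambda>j. \<zeta> j t" "{1..n}"] by auto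
  \<comment> \<open>\<open>J\<close> selects one index for every distinct pole at time \<open>t\<close>, and \<open>r\<close> is its multiplicity.\<close>
  define r where "r i = card {j \<in> {1..n}. \<zeta> j t = \<zeta> i t}" for i
  define X where "X = {1..m} <+> J"
  define a where "a = case_sum \<omega> \<zeta>"
  define \<rho> where "\<rho> = case_sum (\<lambda>_::nat. 1) (\<lambda>i. - of_nat (r i) :: complex)"
  have Jfin: "finite J" using J(1) finite_subset by auto
  have Xfin: "finite X" unfolding X_def using Jfin by simp
  have group: "(\<Sum>j=1..n. h (\<zeta> j s)) = (\<Sum>i\<in>J. of_nat (r i) * h (\<zeta> i s))"
    if "\<forall>i\<in>{1..n}. \<forall>j\<in>{1..n}. \<zeta> i t = \<zeta> j t \<longrightarrow> \<zeta> i s = \<zeta> j s" for h :: "complex \<Rightarrow> complex" and s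
    unfolding r_def
    by (rule sum_group_representatives[OF finite_atLeastAtMost J(1,3,2), where v = "\<lambda>j. \<zeta> j s" and h = h])
       (use that in blast)
  have ldX: "log_deriv z s = (\<Sum>x\<in>X. \<rho> x / (z - a x s))"
    if "\<forall>i\<in>{1..n}. \<forall>j\<in>{1..n}. \<zeta> i t = \<zeta> j t \<longrightarrow> \<zeta> i s = \<zeta> j s" for z s
    unfolding log_deriv_def group[OF that, of "\<lambda>w. 1 / (z - w)"] X_def \<rho>_def a_def
    using Jfin by (simp add: sum.Plus o_def sum_negf)
  have aX: "(\<lambda>x. a x t) ` X = (\<lambda>k. \<omega> k t) ` {1..m} \<union> (\<lambda>j. \<zeta> j t) ` {1..n}"
    unfolding J(2) X_def a_def Plus_def by (simp add: image_Un image_image)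
  have inj: "inj_on (\<lambda>x. a x t) X"
  proof (rule inj_onI)
    fix x y assume xy: "x \<in> X" "y \<in> X" "a x t = a y t"
    have nc: "\<omega> k t \<noteq> \<zeta> j t" "\<zeta> j t \<noteq> \<omega> k t" if "k \<in> {1..m}" "j \<in> J" for k j
      using no_cancel[OF that(1) _ t, of j] that(2) J(1) by auto
    have mem: "Inl k \<in> X \<longleftrightarrow> k \<in> {1..m}" "Inr j \<in> X \<longleftrightarrow> j \<in> J" for k j
      by (auto simp: X_def)
    show "x = y"
      using xy by (cases x; cases y)
        (auto simp: mem a_def nc dest: inj_onD[OF simple_zeros[OF t]] inj_onD[OF J(3)])
  qed
  have rnz: "r i \<noteq> 0" if "i \<in> J" for i
  proof -
    have "i \<in> {j \<in> {1..n}. \<zeta> j t = \<zeta> i t}" using that J(1) by blast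
    then have "{j \<in> {1..n}. \<zeta> j t = \<zeta> i t} \<noteq> {}" by blast
    moreover have "finite {j \<in> {1..n}. \<zeta> j t = \<zeta> i t}" by simp
    ultimately show ?thesis unfolding r_def by (simp only: card_eq_0_iff) simp
  qed
  have \<rho>nz: "\<rho> x \<noteq> 0" if "x \<in> X" for x
    using that by (auto simp: X_def \<rho>_def dest: rnz)
  have out: "norm (a x t) > 1" if "x \<in> X" for x
    using that J(1) \<omega>_outside[OF _ t] \<zeta>_outside[OF _ t] by (auto simp: X_def a_def)
  have cont: "(a x \<longlongrightarrow> a x t) (at t within I)" if "x \<in> X" for x
    using that J(1) \<omega>_tendsto[OF _ t] \<zeta>_tendsto[OF _ t] by (auto simp: X_def a_def)
  have evn: "\<forall>\<^sub>F s in nhds t. s \<in> I \<longrightarrow> (\<forall>i\<in>{1..n}. \<forall>j\<in>{1..n}. \<zeta> i t = \<zeta> j t \<longrightarrow> \<zeta> i s = \<zeta> j s)"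
    using persist unfolding eventually_at_filter by eventually_elim auto
  have der: "((\<lambda>s. \<Sum>x\<in>X. \<rho> x / (z - a x s)) has_vector_derivative deriv (\<lambda>z. deriv F z / g z t) z) (at t within I)"
    if z: "z \<in> ball 0 1" for z
  proof -
    have "\<forall>\<^sub>F s in nhds t. s \<in> I \<longrightarrow> log_deriv z s = (\<Sum>x\<in>X. \<rho> x / (z - a x s))"
      using evn by eventually_elim (use ldX in blast)
    from has_vector_derivative_cong_ev[OF this ldX] Fld[OF z] show ?thesis by blast
  qed
  obtain v where v: "\<And>x. x \<in> X \<Longrightarrow> (a x has_vector_derivative v x) (at t within I)"
    and Fv: "\<And>z. z \<in> ball 0 1 \<Longrightarrow> deriv (\<lambda>z. deriv F z / g z t) z = (\<Sum>x\<in>X. \<rho> x * v x / (z - a x t)\<^sup>2)"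
    by (rule simple_poles_differentiable[OF Xfin islimpt_I[OF t] cont inj \<rho>nz out der]) (assumption+, rule that)
  have avoid: "\<And>k. k \<in> {1..m} \<Longrightarrow> z \<noteq> \<omega> k t" "\<And>j. j \<in> {1..n} \<Longrightarrow> z \<noteq> \<zeta> j t"
    if "z \<notin> (\<lambda>x. a x t) ` X" for z
    using that unfolding aX by auto
  have gder: "((\<lambda>z. g z t) has_field_derivative g z t * (\<Sum>y\<in>X. \<rho> y / (z - a y t))) (at z)"
    if "z \<notin> (\<lambda>x. a x t) ` X" for z
    using g_has_field_derivative[OF t avoid[OF that]] ldX[of t z] by simp
  have gnz: "g z t \<noteq> 0" if "z \<notin> (\<lambda>x. a x t) ` X" for z
    by (rule g_nonzero[OF t avoid[OF that]])
  have pv: "\<rho> x * v x = \<rho> x * (a x t * reflect (Poisson t) (a x t))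
      - \<kappa> * (2 * of_real (q t) / reflect (\<lambda>z. g z t) (a x t) * (1 + (\<Sum>y\<in>X. cnj (\<rho> y) / (1 - cnj (a y t) * a x t))))"
    if "x \<in> X" "((\<lambda>z. (z - a x t) / g z t) \<longlongrightarrow> \<kappa>) (at (a x t))" for x \<kappa>
    by (rule pole_velocity[OF Xfin inj out gder gnz F Fv that, folded Poisson_def])
  have Ssum: "(\<Sum>y\<in>X. cnj (\<rho> y) / (1 - cnj (a y t) * w)) =
      (\<Sum>j=1..m. 1 / (1 - cnj (\<omega> j t) * w)) - (\<Sum>j=1..n. 1 / (1 - cnj (\<zeta> j t) * w))" for w
  proof -
    have "(\<Sum>j=1..n. 1 / (1 - cnj (\<zeta> j t) * w)) = (\<Sum>i\<in>J. of_nat (r i) * (1 / (1 - cnj (\<zeta> i t) * w)))"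
      by (rule group[of t "\<lambda>z. 1 / (1 - cnj z * w)"]) simp
    then show ?thesis
      unfolding X_def \<rho>_def a_def using Jfin by (simp add: sum.Plus o_def sum_negf)
  qed
  show "(\<omega> k has_vector_derivative \<omega> k t * reflect (Poisson t) (\<omega> k t)
      - 1 / deriv (\<lambda>z. g z t) (\<omega> k t) * (2 * of_real (q t) / reflect (\<lambda>z. g z t) (\<omega> k t) *
          (1 + ((\<Sum>j=1..m. 1 / (1 - cnj (\<omega> j t) * \<omega> k t))
             - (\<Sum>j=1..n. 1 / (1 - cnj (\<zeta> j t) * \<omega> k t)))))) (at t within I)" if k: "k \<in> {1..m}"
  proof -
    have kX: "Inl k \<in> X" using k by (auto simp: X_def)
    have ak: "a (Inl k) = \<omega> k" "\<rho> (Inl k) = 1" by (simp_all add: a_def \<rho>_def)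
    from pv[OF kX, unfolded ak, OF zero_quotient_tendsto[OF t k]] v[OF kX]
    show ?thesis by (simp add: ak Ssum)
  qed
  show "(\<zeta> j has_vector_derivative \<zeta> j t * reflect (Poisson t) (\<zeta> j t)) (at t within I)"
    if j: "j \<in> {1..n}"
  proof -
    \<comment> \<open>\<open>j\<close> need not lie in \<open>J\<close>; its representative
      \<open>i\<close> describes the same pole near \<open>t\<close>, so the derivative
      transfers.\<close>
    have "\<zeta> j t \<in> (\<lambda>j. \<zeta> j t) ` J" using j J(2) by blast
    then obtain i where i: "i \<in> J" "\<zeta> j t = \<zeta> i t" by auto
    have iX: "Inr i \<in> X" and i1: "i \<in> {1..n}" using i J(1) by (auto simp: X_def)
    have ai: "a (Inr i) = \<zeta> i" by (simp add: a_def)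
    from pv[OF iX, unfolded ai, OF pole_quotient_tendsto[OF t i1]] \<rho>nz[OF iX]
    have "v (Inr i) = \<zeta> i t * reflect (Poisson t) (\<zeta> i t)" by simp
    with v[OF iX] have "(\<zeta> i has_vector_derivative \<zeta> j t * reflect (Poisson t) (\<zeta> j t)) (at t within I)"
      by (simp add: ai i)
    moreover have "\<forall>\<^sub>F s in nhds t. s \<in> I \<longrightarrow> \<zeta> j s = \<zeta> i s"
      using evn by eventually_elim (use i i1 j in blast)
    ultimately show ?thesis by (subst has_vector_derivative_cong_ev[where f = "\<zeta> j" and g = "\<zeta> i" and x = t, OF _ i(2)])
  qed
qed

section \<open>Bounds for the velocity field of the poles, locally uniform in time\<close>

lemma g_circle_continuous: "t \<in> I \<Longrightarrow> continuous_on (sphere 0 1) (\<lambda>z. g z t)"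
proof (rule continuous_at_imp_continuous_on, rule ballI)
  fix z :: complex assume t: "t \<in> I" and "z \<in> sphere 0 1"
  then have z: "norm z \<le> 1" by simp
  show "isCont (\<lambda>z. g z t) z"
    by (rule DERIV_isCont[OF g_has_field_derivative[OF t]]) (use disc_avoids[OF t z] in blast)+
qed

text \<open>Continuity of \<open>b\<close> is recovered from that of \<open>g 0 s\<close>, which is
  differentiable in time, and of the roots, none of which is 0.\<close>

lemma b_tendsto:
  assumes t: "t \<in> I"
  shows "(b \<longlongrightarrow> b t) (at t within I)"
proof -
  obtain F where "continuous_on (cball 0 1) F" "F holomorphic_on ball 0 1" "F 0 = 0"
    "\<And>z. norm z = 1 \<Longrightarrow> Re (F z * cnj (z * g z t)) = q t"
    "Im (deriv F 0 / g 0 t) = 0"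
    and gd: "\<And>z. z \<in> ball 0 1 \<Longrightarrow> ((\<lambda>s. g z s) has_vector_derivative deriv F z) (at t within I)"
    and "\<And>z. z \<in> ball 0 1 \<Longrightarrow> (log_deriv z has_vector_derivative deriv (\<lambda>z. deriv F z / g z t) z) (at t within I)"
    by (rule time_derivatives[OF t]) (rule that; assumption)
  have "((\<lambda>s. g 0 s) \<longlongrightarrow> g 0 t) (at t within I)"
    using has_vector_derivative_continuous[OF gd[of 0]] by (simp add: continuous_within)
  moreover have nz: "(\<Prod>k=1..m. 0 - \<omega> k s) \<noteq> 0" "(\<Prod>j=1..n. 0 - \<zeta> j s) \<noteq> 0" if "s \<in> I" for s
    using disc_avoids[OF that, of 0, symmetric] by simp_all
  ultimately have "((\<lambda>s. g 0 s * (\<Prod>j=1..n. 0 - \<zeta> j s) / (\<Prod>k=1..m. 0 - \<omega> k s)) \<longlongrightarrow>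
      g 0 t * (\<Prod>j=1..n. 0 - \<zeta> j t) / (\<Prod>k=1..m. 0 - \<omega> k t)) (at t within I)"
    by (intro tendsto_divide tendsto_mult tendsto_prod tendsto_diff tendsto_const \<omega>_tendsto \<zeta>_tendsto t nz)
  moreover have "g 0 s * (\<Prod>j=1..n. 0 - \<zeta> j s) / (\<Prod>k=1..m. 0 - \<omega> k s) = b s" if "s \<in> I" for s
    using nz[OF that] by (simp add: g_form[OF that])
  ultimately show ?thesis
    using t by (auto intro: Lim_transform_eventually simp: eventually_at_filter)
qed

lemma circle_density_bound:
  assumes t: "t \<in> I"
  obtains B where "0 \<le> B"
    "\<forall>\<^sub>F s in at t within I. \<forall>z. norm z = 1 \<longrightarrow> \<bar>q s / (norm (g z s))\<^sup>2\<bar> \<le> B"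
proof -
  \<comment> \<open>A lower bound for \<open>norm (g z s)\<close> on the circle, from the triangle
    inequality in each factor. It is free of \<open>z\<close> and continuous in \<open>s\<close>, so
    that the resulting bound is uniform on the circle.\<close>
  define low where "low s = norm (b s) * (\<Prod>k=1..m. norm (\<omega> k s) - 1) / (\<Prod>j=1..n. 1 + norm (\<zeta> j s))" for s
  have D: "(\<Prod>j=1..n. 1 + norm (\<zeta> j s)) > 0" for s by (intro prod_pos) (simp add: add_pos_nonneg)
  have low_pos: "low s > 0" if "s \<in> I" for s
    unfolding low_def using b_nz[OF that] \<omega>_outside[OF _ that]
    by (intro divide_pos_pos[OF _ D] mult_pos_pos prod_pos) auto
  have low_lim: "(low \<longlongrightarrow> low t) (at t within I)"
    unfolding low_def
    by (intro tendsto_divide tendsto_mult tendsto_prod tendsto_diff tendsto_add tendsto_const tendsto_norm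
        \<omega>_tendsto \<zeta>_tendsto b_tendsto t less_imp_neq[OF D, symmetric])
  have low_le: "low s \<le> norm (g z s)" if s: "s \<in> I" and z: "norm z = 1" for s z
  proof -
    have "(\<Prod>k=1..m. norm (\<omega> k s) - 1) \<le> (\<Prod>k=1..m. norm (z - \<omega> k s))"
    proof (rule prod_mono)
      fix k assume "k \<in> {1..m}"
      then show "0 \<le> norm (\<omega> k s) - 1 \<and> norm (\<omega> k s) - 1 \<le> norm (z - \<omega> k s)"
        using \<omega>_outside[of k s] s z norm_triangle_ineq2[of "\<omega> k s" z] by (auto simp: norm_minus_commute)
    qed
    moreover have "(\<Prod>j=1..n. norm (z - \<zeta> j s)) \<le> (\<Prod>j=1..n. 1 + norm (\<zeta> j s))"
      using norm_triangle_ineq4[of z] z by (intro prod_mono) auto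
    moreover have "0 < (\<Prod>j=1..n. norm (z - \<zeta> j s))"
      using disc_avoids(2)[OF s, of z] z by (intro prod_pos) auto
    ultimately have "low s \<le> norm (b s) * (\<Prod>k=1..m. norm (z - \<omega> k s)) / (\<Prod>j=1..n. norm (z - \<zeta> j s))"
      unfolding low_def by (intro frac_le mult_left_mono mult_nonneg_nonneg prod_nonneg) auto
    then show ?thesis by (simp add: g_form[OF s] norm_mult norm_divide prod_norm)
  qed
  define B where "B = \<bar>q t\<bar> / (low t)\<^sup>2 + 1"
  have "((\<lambda>s. \<bar>q s\<bar> / (low s)\<^sup>2) \<longlongrightarrow> \<bar>q t\<bar> / (low t)\<^sup>2) (at t within I)"
    using q_cont t low_pos[OF t]
    by (intro tendsto_divide tendsto_rabs tendsto_power low_lim) (auto simp: continuous_on_def)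
  then have "\<forall>\<^sub>F s in at t within I. \<bar>q s\<bar> / (low s)\<^sup>2 < B"
    by (rule order_tendstoD) (simp add: B_def)
  moreover have "\<forall>\<^sub>F s in at t within I. s \<in> I" by (simp add: eventually_at_filter)
  ultimately have "\<forall>\<^sub>F s in at t within I. \<forall>z. norm z = 1 \<longrightarrow> \<bar>q s / (norm (g z s))\<^sup>2\<bar> \<le> B"
  proof eventually_elim
    case (elim s)
    have "\<bar>q s / (norm (g z s))\<^sup>2\<bar> \<le> B" if z: "norm z = 1" for z
    proof -
      have "\<bar>q s\<bar> / (norm (g z s))\<^sup>2 \<le> \<bar>q s\<bar> / (low s)\<^sup>2"
        using low_le[OF elim(2) z] low_pos[OF elim(2)]
        by (intro divide_left_mono power_mono mult_pos_pos) auto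
      then show ?thesis using elim(1) by (simp add: abs_divide)
    qed
    then show ?case by blast
  qed
  moreover have "0 \<le> B" by (simp add: B_def)
  ultimately show thesis using that by blast
qed

text \<open>Reflection sends \<open>R \<le> norm z\<close> into the disc of radius
  \<open>1 / R\<close>, away from the singularities of the Schwarz kernel, and does not increase
  distances there. The product rule combines the bound \<open>K1\<close> and the Lipschitz constant
  \<open>K2\<close> of the reflected integral. One constant serves all times near \<open>t\<close>,
  as the Gronwall argument requires.\<close>

lemma pole_velocity_lipschitz:
  assumes t: "t \<in> I" and R: "1 < R"
  obtains K where "0 \<le> K" "\<forall>\<^sub>F s in at t within I. \<forall>z w. R \<le> norm z \<and> norm z \<le> M \<and> R \<le> norm w \<and> norm w \<le> M
      \<longrightarrow> norm (z * reflect (Poisson s) z - w * reflect (Poisson s) w) \<le> K * norm (z - w)"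
proof -
  obtain B where B: "0 \<le> B" "\<forall>\<^sub>F s in at t within I. \<forall>z. norm z = 1 \<longrightarrow> \<bar>q s / (norm (g z s))\<^sup>2\<bar> \<le> B"
    by (rule circle_density_bound[OF t])
  define r where "r = 1 / R"
  have r: "r < 1" using R by (simp add: r_def)
  define K1 K2 where "K1 = B * (2 / (1 - r))" and "K2 = B * (2 / (1 - r)\<^sup>2)"
  have K12: "0 \<le> K1" "0 \<le> K2" using B r by (simp_all add: K1_def K2_def)
  have "\<forall>\<^sub>F s in at t within I. s \<in> I" by (simp add: eventually_at_filter)
  with B(2) have "\<forall>\<^sub>F s in at t within I. \<forall>z w. R \<le> norm z \<and> norm z \<le> M \<and> R \<le> norm w \<and> norm w \<le> M
      \<longrightarrow> norm (z * reflect (Poisson s) z - w * reflect (Poisson s) w) \<le> (K1 + \<bar>M\<bar> * K2) * norm (z - w)"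
  proof eventually_elim
    case (elim s)
    have cont: "continuous_on (sphere 0 1) (\<lambda>z. q s / (norm (g z s))\<^sup>2)"
      using g_nonzero_on_disc[OF elim(2)] by (intro continuous_intros g_circle_continuous elim) auto
    have "norm (z * reflect (Poisson s) z - w * reflect (Poisson s) w) \<le> (K1 + \<bar>M\<bar> * K2) * norm (z - w)"
      if zw: "R \<le> norm z" "norm z \<le> M" "R \<le> norm w" "norm w \<le> M" for z w
    proof -
      have nz: "z \<noteq> 0" "w \<noteq> 0" using zw R by auto
      have inv: "norm (1 / cnj z) \<le> r" "norm (1 / cnj w) \<le> r"
        using zw R by (auto simp: norm_divide r_def intro!: divide_left_mono mult_pos_pos)
      have 1: "norm (reflect (Poisson s) z) \<le> K1"
        unfolding reflect_def Poisson_def K1_def complex_mod_cnj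
        by (rule schwarz_integral_bound[OF cont _ inv(1) r B(1)]) (use elim(1) in blast)
      have "norm (1 / cnj z - 1 / cnj w) = norm (z - w) / (norm z * norm w)"
      proof -
        have "1 / cnj z - 1 / cnj w = cnj ((w - z) / (z * w))" using nz by (simp add: divide_simps)
        then have "norm (1 / cnj z - 1 / cnj w) = norm ((w - z) / (z * w))" by (simp only: complex_mod_cnj)
        then show ?thesis by (simp add: norm_divide norm_mult norm_minus_commute)
      qed
      also have "\<dots> \<le> norm (z - w) / 1"
        using zw R mult_mono[of 1 "norm z" 1 "norm w"] by (intro divide_left_mono) auto
      finally have i: "norm (1 / cnj z - 1 / cnj w) \<le> norm (z - w)" by simp
      have "norm (reflect (Poisson s) z - reflect (Poisson s) w) \<le> K2 * norm (1 / cnj z - 1 / cnj w)"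
        unfolding reflect_def Poisson_def K2_def complex_cnj_diff[symmetric] complex_mod_cnj
        by (rule schwarz_integral_lipschitz[OF cont _ inv r B(1)]) (use elim(1) in blast)
      also have "\<dots> \<le> K2 * norm (z - w)" using i K12 by (intro mult_left_mono)
      finally have 2: "norm (reflect (Poisson s) z - reflect (Poisson s) w) \<le> K2 * norm (z - w)" .
      have "z * reflect (Poisson s) z - w * reflect (Poisson s) w =
          (z - w) * reflect (Poisson s) z + w * (reflect (Poisson s) z - reflect (Poisson s) w)"
        by (simp add: algebra_simps)
      also have "norm \<dots> \<le> norm (z - w) * K1 + \<bar>M\<bar> * (K2 * norm (z - w))"
        unfolding norm_mult using 1 2 zw K12
        by (intro order_trans[OF norm_triangle_ineq] add_mono) (auto simp: norm_mult intro!: mult_mono)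
      finally show ?thesis by (simp add: algebra_simps)
    qed
    then show ?case by blast
  qed
  moreover have "0 \<le> K1 + \<bar>M\<bar> * K2" using K12 by simp
  ultimately show thesis using that by blast
qed

section \<open>Poles neither split nor merge\<close>

definition num_poles :: "real \<Rightarrow> nat" where
  "num_poles t = card ((\<lambda>j. \<zeta> j t) ` {1..n})"

lemma poles_stay_distinct:
  assumes t: "t \<in> I"
  shows "\<forall>\<^sub>F s in at t within I. \<forall>i\<in>{1..n}. \<forall>j\<in>{1..n}. \<zeta> i t \<noteq> \<zeta> j t \<longrightarrow> \<zeta> i s \<noteq> \<zeta> j s"
proof (intro eventually_ball_finite ballI finite_atLeastAtMost)
  fix i j assume ij: "i \<in> {1..n}" "j \<in> {1..n}"
  show "\<forall>\<^sub>F s in at t within I. \<zeta> i t \<noteq> \<zeta> j t \<longrightarrow> \<zeta> i s \<noteq> \<zeta> j s"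
  proof (cases "\<zeta> i t = \<zeta> j t")
    case False
    have "((\<lambda>s. \<zeta> i s - \<zeta> j s) \<longlongrightarrow> \<zeta> i t - \<zeta> j t) (at t within I)"
      by (intro tendsto_diff \<zeta>_tendsto ij t)
    from tendsto_imp_eventually_ne[OF this, of 0] False
    have "\<forall>\<^sub>F s in at t within I. \<zeta> i s - \<zeta> j s \<noteq> 0" by simp
    then show ?thesis by eventually_elim simp
  qed simp
qed

text \<open>Distinct poles stay distinct by continuity, so their number cannot drop near
  \<open>t\<close>; by maximality it cannot rise. Equal numbers force the coincidences at
  \<open>t\<close> to persist.\<close>

lemma max_num_poles_stable:
  assumes t: "t \<in> I" and max: "\<And>s. s \<in> I \<Longrightarrow> num_poles s \<le> num_poles t"
  shows "\<forall>\<^sub>F s in at t within I. num_poles s = num_poles t \<and>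
    (\<forall>i\<in>{1..n}. \<forall>j\<in>{1..n}. \<zeta> i t = \<zeta> j t \<longrightarrow> \<zeta> i s = \<zeta> j s)"
proof -
  have "\<forall>\<^sub>F s in at t within I. s \<in> I" by (simp add: eventually_at_filter)
  with poles_stay_distinct[OF t] show ?thesis
  proof eventually_elim
    case (elim s)
    have "\<zeta> i t = \<zeta> j t" if "i \<in> {1..n}" "j \<in> {1..n}" "\<zeta> i s = \<zeta> j s" for i j
      using elim(1) that by blast
    note fac = card_image_le_if_factors[of "{1..n}" "\<lambda>j. \<zeta> j s" "\<lambda>j. \<zeta> j t", OF finite_atLeastAtMost this,
        folded num_poles_def]
    have le: "num_poles t \<le> num_poles s" by (rule fac(1))
    have "\<zeta> i s = \<zeta> j s" if "i \<in> {1..n}" "j \<in> {1..n}" "\<zeta> i t = \<zeta> j t" for i j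
      by (rule fac(2)[OF _ _ _ max[OF elim(2)] that])
    moreover have "num_poles s = num_poles t" using le max[OF elim(2)] by simp
    ultimately show ?case by blast
  qed
qed

text \<open>The segment may point in either time direction.\<close>

lemma collision_persists:
  assumes c: "c \<in> I" and a: "closed_segment a c \<subseteq> I" "a \<noteq> c"
    and der: "\<And>s l. s \<in> open_segment a c \<Longrightarrow> l \<in> {1..n} \<Longrightarrow>
      (\<zeta> l has_vector_derivative \<zeta> l s * reflect (Poisson s) (\<zeta> l s)) (at s)"
    and ij: "i \<in> {1..n}" "j \<in> {1..n}" "\<zeta> i c = \<zeta> j c"
  shows "\<forall>\<^sub>F s in at c within closed_segment a c. \<zeta> i s = \<zeta> j s"
proof -
  \<comment> \<open>Near \<open>c\<close> both poles stay between the radii \<open>R\<close> and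
    \<open>M\<close>, where the Lipschitz bound holds; \<open>R\<close> is the midpoint of 1 and
    \<open>norm (\<zeta> i c)\<close>.\<close>
  define R M where "R = (1 + norm (\<zeta> i c)) / 2" and "M = norm (\<zeta> i c) + 1"
  have out: "norm (\<zeta> i c) > 1" by (rule \<zeta>_outside[OF ij(1) c])
  then have R: "1 < R" "R < norm (\<zeta> i c)" "norm (\<zeta> i c) < M" by (auto simp: R_def M_def)
  obtain K where K: "0 \<le> K" "\<forall>\<^sub>F s in at c within I. \<forall>z w. R \<le> norm z \<and> norm z \<le> M \<and> R \<le> norm w \<and> norm w \<le> M
      \<longrightarrow> norm (z * reflect (Poisson s) z - w * reflect (Poisson s) w) \<le> K * norm (z - w)"
    by (rule pole_velocity_lipschitz[OF c R(1)])
  have near: "\<forall>\<^sub>F s in at c within I. R < norm (\<zeta> l s) \<and> norm (\<zeta> l s) < M" if "l \<in> {i, j}" for l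
  proof -
    have "((\<lambda>s. norm (\<zeta> l s)) \<longlongrightarrow> norm (\<zeta> i c)) (at c within I)"
      using tendsto_norm[OF \<zeta>_tendsto[OF _ c, of l]] that ij by auto
    from eventually_conj[OF order_tendstoD(1)[OF this R(2)] order_tendstoD(2)[OF this R(3)]]
    show ?thesis by simp
  qed
  have "\<forall>\<^sub>F s in at c within I. norm (\<zeta> i s * reflect (Poisson s) (\<zeta> i s) - \<zeta> j s * reflect (Poisson s) (\<zeta> j s))
      \<le> K * norm (\<zeta> i s - \<zeta> j s)"
    using K(2) near[of i, simplified] near[of j, simplified] by eventually_elim auto
  then obtain d where d: "d > 0" "\<And>s. s \<in> I \<Longrightarrow> s \<noteq> c \<Longrightarrow> dist s c < d \<Longrightarrow>
      norm (\<zeta> i s * reflect (Poisson s) (\<zeta> i s) - \<zeta> j s * reflect (Poisson s) (\<zeta> j s)) \<le> K * norm (\<zeta> i s - \<zeta> j s)"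
    unfolding eventually_at by auto
  \<comment> \<open>Small enough to stay in the segment and in the range of the Lipschitz bound, and
    to give \<open>K * e \<le> 1 / 2\<close>; \<open>K + 1\<close> avoids division by 0.\<close>
  define e where "e = Min {\<bar>a - c\<bar>, d, 1 / (2 * (K + 1))}"
  have e: "e > 0" "e \<le> \<bar>a - c\<bar>" "e \<le> d" "e \<le> 1 / (2 * (K + 1))"
    using a d(1) K(1) by (auto simp: e_def)
  define a' where "a' = c + e * sgn (a - c)"
  have dist_a': "\<bar>a' - c\<bar> = e" using a(2) e(1) by (simp add: a'_def abs_mult sgn_if)
  have a'_side: "a' < c \<and> a \<le> a' \<or> c < a' \<and> a' \<le> a"
    using a(2) e by (auto simp: a'_def sgn_if)
  have seg: "closed_segment a' c \<subseteq> closed_segment a c" "open_segment a' c \<subseteq> open_segment a c"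
    using a'_side by (auto simp: closed_segment_eq_real_ivl open_segment_eq_real_ivl)
  have zero: "\<zeta> i s - \<zeta> j s = 0" if s: "s \<in> closed_segment a' c" for s
  proof (rule gronwall_vanish[where w = "\<lambda>s. \<zeta> i s - \<zeta> j s" and K = K, OF _ _ _ _ K(1) _ s])
    show "continuous_on (closed_segment a' c) (\<lambda>s. \<zeta> i s - \<zeta> j s)"
      using seg(1) a(1) ij by (intro continuous_intros continuous_on_subset[OF \<zeta>_cont]) auto
    show "\<zeta> i c - \<zeta> j c = 0" using ij by simp
    show "((\<lambda>s. \<zeta> i s - \<zeta> j s) has_vector_derivative
        \<zeta> i x * reflect (Poisson x) (\<zeta> i x) - \<zeta> j x * reflect (Poisson x) (\<zeta> j x)) (at x)"
      if "x \<in> open_segment a' c" for x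
      using that seg(2) ij by (intro has_vector_derivative_diff der) auto
    show "norm (\<zeta> i x * reflect (Poisson x) (\<zeta> i x) - \<zeta> j x * reflect (Poisson x) (\<zeta> j x)) \<le> K * norm (\<zeta> i x - \<zeta> j x)"
      if x: "x \<in> open_segment a' c" for x
    proof (rule d(2))
      show "x \<in> I" using x seg(2) a(1) open_closed_segment by blast
      show "x \<noteq> c" using x by (auto simp: open_segment_def)
      show "dist x c < d"
        using x dist_a' e(3) by (auto simp: open_segment_eq_real_ivl dist_real_def split: if_splits)
    qed
    have "K * e \<le> K * (1 / (2 * (K + 1)))" using K(1) e by (intro mult_left_mono)
    also have "\<dots> \<le> 1 / 2" using K(1) by (simp add: field_simps)
    finally show "K * \<bar>a' - c\<bar> \<le> 1 / 2" by (simp add: dist_a')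
  qed
  have "s \<in> closed_segment a' c" if "s \<in> closed_segment a c" "dist s c < e" for s
    using that a'_side dist_a' by (auto simp: closed_segment_eq_real_ivl dist_real_def split: if_splits)
  then show ?thesis
    unfolding eventually_at using e(1) zero by (intro exI[of _ e]) force
qed

text \<open>As \<open>s\<close> and \<open>t\<close> are arbitrary, the number of distinct poles is
  constant. The set \<open>U\<close> where it is maximal is open in \<open>I\<close> by stability;
  the work is to show that \<open>U\<close> has no boundary point in \<open>I\<close>.\<close>

lemma num_poles_le:
  assumes s: "s \<in> I" and t: "t \<in> I"
  shows "num_poles s \<le> num_poles t"
proof -
  have "num_poles x \<le> n" for x
    using card_image_le[OF finite_atLeastAtMost, of "\<lambda>j. \<zeta> j x" 1 n] by (simp add: num_poles_def)
  then have "num_poles ` I \<subseteq> {..n}" by blast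
  then have fin: "finite (num_poles ` I)" by (rule finite_subset) simp
  then have "Max (num_poles ` I) \<in> num_poles ` I" using t by (intro Max_in) auto
  then obtain s1 where s1: "s1 \<in> I" "num_poles s1 = Max (num_poles ` I)" by auto
  have max: "num_poles x \<le> num_poles s1" if "x \<in> I" for x
    using fin that s1(2) by simp
  define U where "U = {x \<in> I. num_poles x = num_poles s1}"
  have stable: "\<forall>\<^sub>F y in at x within I. num_poles y = num_poles x \<and>
    (\<forall>i\<in>{1..n}. \<forall>j\<in>{1..n}. \<zeta> i x = \<zeta> j x \<longrightarrow> \<zeta> i y = \<zeta> j y)" if "x \<in> U" for x
    using that max by (intro max_num_poles_stable) (auto simp: U_def)
  have "openin (top_of_set I) U"
    unfolding openin_contains_ball
  proof (intro conjI ballI)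
    fix x assume x: "x \<in> U"
    then obtain d where d: "d > 0" "\<And>y. y \<in> I \<Longrightarrow> y \<noteq> x \<Longrightarrow> dist y x < d \<Longrightarrow> num_poles y = num_poles x"
      using stable[OF x] unfolding eventually_at by auto
    have "y \<in> U" if "y \<in> ball x d \<inter> I" for y
      using that d(2)[of y] x by (cases "y = x") (auto simp: U_def dist_commute)
    with d(1) show "\<exists>e>0. ball x e \<inter> I \<subseteq> U" by blast
  qed (auto simp: U_def)
  then obtain T where T: "open T" "U = I \<inter> T" by (auto simp: openin_open)
  have "I \<subseteq> U"
  proof (rule ccontr)
    assume "\<not> I \<subseteq> U"
    then obtain t0 where t0: "t0 \<in> I" "t0 \<notin> U" by blast
    have segI: "closed_segment s1 t0 \<subseteq> I"
      using s1(1) t0(1) interval by (intro closed_segment_subset) (auto simp: is_interval_convex_1)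
    \<comment> \<open>The part of the segment outside \<open>U\<close>. Its point \<open>c\<close>
      nearest to \<open>s1\<close> is the first collision on the way to \<open>t0\<close>;
      everything before \<open>c\<close> lies in \<open>U\<close>.\<close>
    define Z where "Z = closed_segment s1 t0 - T"
    have "closed Z" unfolding Z_def using T(1) by (intro closed_Diff closed_segment)
    moreover have "t0 \<in> Z" using t0 T(2) by (auto simp: Z_def)
    ultimately obtain c where c: "c \<in> Z" "\<And>y. y \<in> Z \<Longrightarrow> dist s1 c \<le> dist s1 y"
      using distance_attains_inf[of Z s1] by blast
    have cI: "c \<in> I" "c \<notin> U" using c(1) segI T(2) by (auto simp: Z_def)
    have sc: "s1 \<noteq> c" using cI s1 by (auto simp: U_def)
    have csub: "closed_segment s1 c \<subseteq> closed_segment s1 t0"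
      using c(1) by (intro closed_segment_subset) (auto simp: Z_def)
    have inU: "x \<in> U" if "x \<in> closed_segment s1 c" "x \<noteq> c" for x
    proof -
      have "dist s1 x < dist s1 c"
        using that by (auto simp: closed_segment_eq_real_ivl dist_real_def split: if_splits)
      then have "x \<notin> Z" using c(2)[of x] by auto
      then show ?thesis using that(1) csub segI T(2) by (auto simp: Z_def)
    qed
    have der: "(\<zeta> l has_vector_derivative \<zeta> l x * reflect (Poisson x) (\<zeta> l x)) (at x)"
      if x: "x \<in> open_segment s1 c" and l: "l \<in> {1..n}" for x l
    proof -
      have xU: "x \<in> U" using x inU by (auto simp: open_segment_def)
      have "open (open_segment s1 c)" by (simp add: open_segment_eq_real_ivl)
      moreover have "open_segment s1 c \<subseteq> I"
        using csub segI by (auto simp: open_segment_def)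
      ultimately have "at x within I = at x" using x at_within_open_subset by blast
      moreover have "(\<zeta> l has_vector_derivative \<zeta> l x * reflect (Poisson x) (\<zeta> l x)) (at x within I)"
        using xU by (intro velocities(2) eventually_mono[OF stable[OF xU]] l) (simp add: U_def, blast)
      ultimately show ?thesis by simp
    qed
    let ?F = "at c within closed_segment s1 c"
    have "\<forall>\<^sub>F x in ?F. \<forall>i\<in>{1..n}. \<forall>j\<in>{1..n}. \<zeta> i c = \<zeta> j c \<longrightarrow> \<zeta> i x = \<zeta> j x"
    proof (intro eventually_ball_finite ballI finite_atLeastAtMost)
      fix i j assume ij: "i \<in> {1..n}" "j \<in> {1..n}"
      show "\<forall>\<^sub>F x in ?F. \<zeta> i c = \<zeta> j c \<longrightarrow> \<zeta> i x = \<zeta> j x"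
      proof (cases "\<zeta> i c = \<zeta> j c")
        case True
        have "\<forall>\<^sub>F x in ?F. \<zeta> i x = \<zeta> j x"
          by (rule collision_persists[OF cI(1) order_trans[OF csub segI] sc der ij True])
        then show ?thesis by eventually_elim simp
      qed simp
    qed
    moreover have "\<forall>\<^sub>F x in ?F. x \<in> U"
      unfolding eventually_at_filter by (rule always_eventually) (use inU in blast)
    ultimately have "\<forall>\<^sub>F x in ?F. x \<in> U \<and> (\<forall>i\<in>{1..n}. \<forall>j\<in>{1..n}. \<zeta> i c = \<zeta> j c \<longrightarrow> \<zeta> i x = \<zeta> j x)"
      by eventually_elim blast
    moreover have "c islimpt closed_segment s1 c"
    proof (rule connected_imp_perfect)
      show "closed_segment s1 c \<noteq> {x}" for x
        using sc ends_in_segment(1)[of s1 c] ends_in_segment(2)[of c s1] by (metis singletonD)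
    qed auto
    then have "?F \<noteq> bot" by (simp add: trivial_limit_within)
    ultimately obtain x where x: "x \<in> U" "\<forall>i\<in>{1..n}. \<forall>j\<in>{1..n}. \<zeta> i c = \<zeta> j c \<longrightarrow> \<zeta> i x = \<zeta> j x"
      using eventually_happens' by blast
    \<comment> \<open>The coincidences at \<open>c\<close> also hold at \<open>x\<close>, so
      \<open>c\<close> has at least as many distinct poles as \<open>x\<close>, that is, the maximal
      number.\<close>
    have "num_poles x \<le> num_poles c"
      unfolding num_poles_def by (rule card_image_le_if_factors(1)[OF finite_atLeastAtMost]) (use x(2) in blast)
    then have "c \<in> U" using x(1) max[OF cI(1)] cI(1) by (auto simp: U_def)
    with cI(2) show False by contradiction
  qed
  then show ?thesis using s t max by (auto simp: U_def)
qed

text \<open>With \<open>num_poles\<close> constant every time is maximal, so the hypothesis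
  \<open>persist\<close> of \<open>velocities\<close> holds at every time.\<close>

lemma coincidences_stable:
  "t \<in> I \<Longrightarrow> \<forall>\<^sub>F s in at t within I. \<forall>i\<in>{1..n}. \<forall>j\<in>{1..n}. \<zeta> i t = \<zeta> j t \<longrightarrow> \<zeta> i s = \<zeta> j s"
  by (rule eventually_mono[OF max_num_poles_stable]) (use num_poles_le in blast)+

lemma reflect_PG_Poisson:
  assumes t: "t \<in> I"
  shows "reflect (\<lambda>z. PG_Poisson q f z t) = reflect (Poisson t)"
proof -
  have "PG_Poisson q f z t = Poisson t z" for z
    unfolding PG_Poisson_def Poisson_def schwarz_integral_def
    by (intro arg_cong2[of _ _ _ _ "(*)"] refl contour_integral_cong) (simp_all add: g_deriv[OF t])
  then show ?thesis by simp
qed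

end

text \<open>The continuity hypotheses fix a consistent labelling of the roots; differentiability of
  the roots is part of the conclusion, through \<open>has_log_derivative\<close>.\<close>

theorem theorem3p3:
  fixes I :: "real set" and q :: "real \<Rightarrow> real" and f g :: "complex \<Rightarrow> real \<Rightarrow> complex"
    and m n :: nat and b :: "real \<Rightarrow> complex" and \<omega> \<zeta> A :: "nat \<Rightarrow> real \<Rightarrow> complex"
  assumes sol: "locally_univalent_PG_solution I q f"
    and g_form: "\<And>z t. t \<in> I \<Longrightarrow>
        g z t = b t * (\<Prod>k=1..m. z - \<omega> k t) / (\<Prod>j=1..n. z - \<zeta> j t)"
    and g_deriv: "\<And>z t. t \<in> I \<Longrightarrow> z \<in> cball 0 1 \<Longrightarrow> deriv (\<lambda>x. f x t) z = g z t"
    and mn: "m \<ge> n"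
    and b_nz: "\<And>t. t \<in> I \<Longrightarrow> b t \<noteq> 0"
    and \<omega>_outside: "\<And>k t. k \<in> {1..m} \<Longrightarrow> t \<in> I \<Longrightarrow> cmod (\<omega> k t) > 1"
    and \<zeta>_outside: "\<And>j t. j \<in> {1..n} \<Longrightarrow> t \<in> I \<Longrightarrow> cmod (\<zeta> j t) > 1"
    and \<omega>_cont: "\<And>k. k \<in> {1..m} \<Longrightarrow> continuous_on I (\<omega> k)"
    and \<zeta>_cont: "\<And>j. j \<in> {1..n} \<Longrightarrow> continuous_on I (\<zeta> j)"
    and no_cancel: "\<And>k j t. k \<in> {1..m} \<Longrightarrow> j \<in> {1..n} \<Longrightarrow> t \<in> I \<Longrightarrow> \<omega> k t \<noteq> \<zeta> j t"
    and simple_zeros: "\<And>t. t \<in> I \<Longrightarrow> inj_on (\<lambda>k. \<omega> k t) {1..m}"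
    and A: "\<And>k t. k \<in> {1..m} \<Longrightarrow> t \<in> I \<Longrightarrow>
        2 * A k t / \<omega> k t =
        2 * of_real (q t) /
          (\<omega> k t * deriv (\<lambda>z. g z t) (\<omega> k t) * reflect (\<lambda>z. g z t) (\<omega> k t))"
  shows "\<forall>t\<in>I.
    (\<forall>k\<in>{1..m}. has_log_derivative (\<omega> k)
        (reflect (\<lambda>z. PG_Poisson q f z t) (\<omega> k t)
         - 2 * A k t / \<omega> k t *
           (1 + (\<Sum>j=1..m. 1 / (1 - cnj (\<omega> j t) * \<omega> k t))
              - (\<Sum>j=1..n. 1 / (1 - cnj (\<zeta> j t) * \<omega> k t)))) t I) \<and>
    (\<forall>j\<in>{1..n}. has_log_derivative (\<zeta> j)
        (reflect (\<lambda>z. PG_Poisson q f z t) (\<zeta> j t)) t I)"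
proof -
  interpret rational_PG_solution I q f g m n b \<omega> \<zeta>
    by unfold_locales (fact sol g_form g_deriv b_nz \<omega>_outside \<zeta>_outside \<omega>_cont \<zeta>_cont no_cancel simple_zeros)+
  show ?thesis
  proof (intro ballI conjI)
    fix t k assume t: "t \<in> I" and k: "k \<in> {1..m}"
    have nz: "\<omega> k s \<noteq> 0" if "s \<in> I" for s using \<omega>_outside[OF k that] by auto
    let ?S = "(\<Sum>j=1..m. 1 / (1 - cnj (\<omega> j t) * \<omega> k t))" and ?T = "\<Sum>j=1..n. 1 / (1 - cnj (\<zeta> j t) * \<omega> k t)"
    \<comment> \<open>Multiplied by \<open>\<omega> k t\<close>, the asserted logarithmic derivative
      becomes the velocity; the factor \<open>\<omega> k t\<close> in the denominator of
      \<open>A\<close> cancels.\<close>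
    have "\<omega> k t * (reflect (Poisson t) (\<omega> k t) - 2 * A k t / \<omega> k t * (1 + ?S - ?T)) =
        \<omega> k t * reflect (Poisson t) (\<omega> k t) - 1 / deriv (\<lambda>z. g z t) (\<omega> k t) *
          (2 * of_real (q t) / reflect (\<lambda>z. g z t) (\<omega> k t) * (1 + (?S - ?T)))"
      unfolding A[OF k t] using nz[OF t] by (simp add: right_diff_distrib[of "\<omega> k t" "reflect (Poisson t) (\<omega> k t)"] add_diff_eq)
    then show "has_log_derivative (\<omega> k)
        (reflect (\<lambda>z. PG_Poisson q f z t) (\<omega> k t) - 2 * A k t / \<omega> k t * (1 + ?S - ?T)) t I"
      unfolding reflect_PG_Poisson[OF t]
      using velocities(1)[OF t coincidences_stable[OF t] k] by (intro has_log_derivativeI t nz) simp_all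
  next
    fix t j assume t: "t \<in> I" and j: "j \<in> {1..n}"
    have "\<zeta> j s \<noteq> 0" if "s \<in> I" for s using \<zeta>_outside[OF j that] by auto
    then show "has_log_derivative (\<zeta> j) (reflect (\<lambda>z. PG_Poisson q f z t) (\<zeta> j t)) t I"
      unfolding reflect_PG_Poisson[OF t]
      by (intro has_log_derivativeI t velocities(2) coincidences_stable j) auto
  qed
qed

end
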